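(* Let $\mathbf{S}$ be a regular semigroup. Then: (a) $\mathbf{S}$ is nilpotent if and only if it is simple and all its $\mathcal{H}$-classes are nilpotent groups; (b) $\mathbf{S}$ is solvable if and only if it is simple and all its $\mathcal{H}$-classes are solvable groups.
   Context: A semigroup $\mathbf{S}$ is regular if for every $a\in S$ there is $x\in S$ with $axa=a$; it is simple if it has no proper ideals. $\mathcal{H}=\mathcal{L}\cap\mathcal{R}$ is Green's relation. Commutators. $\mathbb{N}=\{1,2,\dots\}$. For an algebra $\mathbf{A}$ and congruences $\alpha,\beta,\delta$ of $\mathbf{A}$, $C(\alpha,\beta;\delta)$ means: for all $n\in\mathbb{N}$, all $(n+1)$-ary term functions $t$ of $\mathbf{A}$, all $a,b\in A$ and $\mathbf{c},\mathbf{d}\in A^n$ with $a\,\alpha\,b$ and $c_i\,\beta\,d_i$ for every $i$, $t(a,\mathbf{c})\,\delta\,t(a,\mathbf{d})$ implies $t(b,\mathbf{c})\,\delta\,t(b,\mathbf{d})$. The commutator $[\alpha,\beta]$ is the least congruence $\delta$ with $C(\alpha,\beta;\delta)$. Semigroups are algebras with one binary operation; groups are algebras $(G,\cdot,{}^{-1},e)$. $0_A$ is the equality relation and $1_A$ the full relation on $A$. Nilpotency and solvability. Put $(\alpha,\beta]^{(1)}=[\alpha,\beta]$, $(\alpha,\beta]^{(k)}=[\alpha,(\alpha,\beta]^{(k-1)}]$ for $k\ge2$, and $[\alpha]^{(1)}=[\alpha,\alpha]$, $[\alpha]^{(k)}=[[\alpha]^{(k-1)},[\alpha]^{(k-1)}]$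 for $k\ge2$. An algebra $\mathbf{A}$ (semigroup or group) is $n$-nilpotent if $(1_A,1_A]^{(n)}=0_A$ and $n$-solvable if $[1_A]^{(n)}=0_A$; it is nilpotent (solvable) if it is $n$-nilpotent ($n$-solvable) for some $n\in\mathbb{N}$. For groups these are the usual notions of nilpotency and solvability. *)

theory Defs
  imports "HOL-Algebra.Group"
begin

section \<open>Algebras, term functions, congruences\<close>

text \<open>
  An operation is a pair of its arity and a function on argument lists; only its values on lists
  of that length over the carrier are relevant. Term functions and congruences depend only on the
  set of basic operations, so no operation symbols are needed.
\<close>

record 'a ualg = "'a partial_object" +
  ualg_ops :: "(nat \<times> ('a list \<Rightarrow> 'a)) set"

definition ualg_closed :: "('a, 'b) ualg_scheme \<Rightarrow> bool" where
  "ualg_closed A \<longleftrightarrow>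
     (\<forall>(k, f) \<in> ualg_ops A. \<forall>xs. length xs = k \<longrightarrow> set xs \<subseteq> carrier A \<longrightarrow> f xs \<in> carrier A)"

inductive_set term_functions :: "('a, 'b) ualg_scheme \<Rightarrow> nat \<Rightarrow> ('a list \<Rightarrow> 'a) set"
  for A :: "('a, 'b) ualg_scheme" and n :: nat
where
  proj: "i < n \<Longrightarrow> (\<lambda>xs. xs ! i) \<in> term_functions A n"
| comp: "(k, f) \<in> ualg_ops A \<Longrightarrow> length ts = k \<Longrightarrow> (\<forall>t \<in> set ts. t \<in> term_functions A n)
    \<Longrightarrow> (\<lambda>xs. f (map (\<lambda>t. t xs) ts)) \<in> term_functions A n"

definition ualg_congruence :: "('a, 'b) ualg_scheme \<Rightarrow> ('a \<times> 'a) set \<Rightarrow> bool" where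
  "ualg_congruence A \<theta> \<longleftrightarrow> equiv (carrier A) \<theta> \<and>
     (\<forall>(k, f) \<in> ualg_ops A. \<forall>xs ys. length xs = k \<longrightarrow> list_all2 (\<lambda>x y. (x, y) \<in> \<theta>) xs ys
        \<longrightarrow> (f xs, f ys) \<in> \<theta>)"

section \<open>Commutators, nilpotency, solvability\<close>

definition centralizes ::
  "('a, 'b) ualg_scheme \<Rightarrow> ('a \<times> 'a) set \<Rightarrow> ('a \<times> 'a) set \<Rightarrow> ('a \<times> 'a) set \<Rightarrow> bool" where
  "centralizes A \<alpha> \<beta> \<delta> \<longleftrightarrow>
     (\<forall>n \<ge> 1. \<forall>t \<in> term_functions A (n + 1). \<forall>a \<in> carrier A. \<forall>b \<in> carrier A. \<forall>c d.
        length c = n \<longrightarrow> length d = n \<longrightarrow> set c \<subseteq> carrier A \<longrightarrow> set d \<subseteq> carrier A \<longrightarrow>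
        (a, b) \<in> \<alpha> \<longrightarrow> (\<forall>i < n. (c ! i, d ! i) \<in> \<beta>) \<longrightarrow>
        (t (a # c), t (a # d)) \<in> \<delta> \<longrightarrow> (t (b # c), t (b # d)) \<in> \<delta>)"

text \<open>Least with respect to inclusion; existence is shown in \<open>ualg_commutator_least\<close> below.\<close>

definition ualg_commutator ::
  "('a, 'b) ualg_scheme \<Rightarrow> ('a \<times> 'a) set \<Rightarrow> ('a \<times> 'a) set \<Rightarrow> ('a \<times> 'a) set" where
  "ualg_commutator A \<alpha> \<beta> = (LEAST \<delta>. ualg_congruence A \<delta> \<and> centralizes A \<alpha> \<beta> \<delta>)"

text \<open>
  The two series for \<open>k \<ge> 1\<close> are \<open>(\<alpha>, \<beta>]\<close> and \<open>[\<alpha>]\<close> with upper index \<open>k\<close>;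
  the value at \<open>0\<close> is chosen so that the recursion yields \<open>[\<alpha>, \<beta>]\<close> and \<open>[\<alpha>, \<alpha>]\<close> at \<open>1\<close>.
\<close>

primrec central_series ::
  "('a, 'b) ualg_scheme \<Rightarrow> ('a \<times> 'a) set \<Rightarrow> ('a \<times> 'a) set \<Rightarrow> nat \<Rightarrow> ('a \<times> 'a) set" where
  "central_series A \<alpha> \<beta> 0 = \<beta>"
| "central_series A \<alpha> \<beta> (Suc k) = ualg_commutator A \<alpha> (central_series A \<alpha> \<beta> k)"

primrec derived_series ::
  "('a, 'b) ualg_scheme \<Rightarrow> ('a \<times> 'a) set \<Rightarrow> nat \<Rightarrow> ('a \<times> 'a) set" where
  "derived_series A \<alpha> 0 = \<alpha>"
| "derived_series A \<alpha> (Suc k) =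
     ualg_commutator A (derived_series A \<alpha> k) (derived_series A \<alpha> k)"

definition zero_cong :: "('a, 'b) ualg_scheme \<Rightarrow> ('a \<times> 'a) set" where
  "zero_cong A = Id_on (carrier A)"

definition one_cong :: "('a, 'b) ualg_scheme \<Rightarrow> ('a \<times> 'a) set" where
  "one_cong A = carrier A \<times> carrier A"

definition ualg_n_nilpotent :: "nat \<Rightarrow> ('a, 'b) ualg_scheme \<Rightarrow> bool" where
  "ualg_n_nilpotent n A \<longleftrightarrow> central_series A (one_cong A) (one_cong A) n = zero_cong A"

definition ualg_n_solvable :: "nat \<Rightarrow> ('a, 'b) ualg_scheme \<Rightarrow> bool" where
  "ualg_n_solvable n A \<longleftrightarrow> derived_series A (one_cong A) n = zero_cong A"

definition ualg_nilpotent :: "('a, 'b) ualg_scheme \<Rightarrow> bool" where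
  "ualg_nilpotent A \<longleftrightarrow> (\<exists>n \<ge> 1. ualg_n_nilpotent n A)"

definition ualg_solvable :: "('a, 'b) ualg_scheme \<Rightarrow> bool" where
  "ualg_solvable A \<longleftrightarrow> (\<exists>n \<ge> 1. ualg_n_solvable n A)"

lemma term_functions_closed:
  assumes A: "ualg_closed A" and t: "t \<in> term_functions A n"
    and xs: "length xs = n" "set xs \<subseteq> carrier A"
  shows "t xs \<in> carrier A"
  using t
proof induction
  case (proj i)
  then show ?case using xs by auto
next
  case (comp k f ts)
  have "set (map (\<lambda>t. t xs) ts) \<subseteq> carrier A" using comp.IH by auto
  moreover have "length (map (\<lambda>t. t xs) ts) = k" using comp.hyps by simp
  ultimately show ?case using A comp.hyps(1) unfolding ualg_closed_def by blast
qed

lemma one_cong_congruence: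
  assumes A: "ualg_closed A"
  shows "ualg_congruence A (one_cong A)"
proof -
  have "equiv (carrier A) (one_cong A)"
    by (auto simp: one_cong_def equiv_def refl_on_def sym_def trans_def)
  moreover have "(f xs, f ys) \<in> one_cong A"
    if "(k, f) \<in> ualg_ops A" "length xs = k" "list_all2 (\<lambda>x y. (x, y) \<in> one_cong A) xs ys"
    for k f xs ys
  proof -
    have "length ys = k" "set xs \<subseteq> carrier A" "set ys \<subseteq> carrier A"
      using that by (auto simp: one_cong_def list_all2_conv_all_nth in_set_conv_nth)
    then show ?thesis using A that(1,2) unfolding ualg_closed_def one_cong_def by blast
  qed
  ultimately show ?thesis unfolding ualg_congruence_def by blast
qed

lemma one_cong_centralizes:
  assumes A: "ualg_closed A"
  shows "centralizes A \<alpha> \<beta> (one_cong A)"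
proof -
  have "t (x # xs) \<in> carrier A"
    if "t \<in> term_functions A (n + 1)" "length xs = n" "x \<in> carrier A" "set xs \<subseteq> carrier A"
    for t n x xs
    using that by (intro term_functions_closed[OF A that(1)]) simp_all
  then show ?thesis unfolding centralizes_def one_cong_def by (intro allI ballI impI SigmaI)
qed

lemma ualg_commutator_least:
  assumes A: "ualg_closed A"
  shows "ualg_congruence A (ualg_commutator A \<alpha> \<beta>)"
    and "centralizes A \<alpha> \<beta> (ualg_commutator A \<alpha> \<beta>)"
    and "\<And>\<delta>. ualg_congruence A \<delta> \<Longrightarrow> centralizes A \<alpha> \<beta> \<delta> \<Longrightarrow> ualg_commutator A \<alpha> \<beta> \<subseteq> \<delta>"
proof -
  let ?F = "{\<delta>. ualg_congruence A \<delta> \<and> centralizes A \<alpha> \<beta> \<delta>}"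
  have one: "one_cong A \<in> ?F"
    using one_cong_congruence[OF A] one_cong_centralizes[OF A] by blast
  have eq: "equiv (carrier A) \<delta>" if "\<delta> \<in> ?F" for \<delta>
    using that by (simp add: ualg_congruence_def)
  have "equiv (carrier A) (\<Inter>?F)"
  proof (rule equivI)
    show "\<Inter>?F \<subseteq> carrier A \<times> carrier A" using one unfolding one_cong_def by blast
    show "refl_on (carrier A) (\<Inter>?F)"
      using eq by (auto simp: equiv_def refl_on_def)
    show "sym (\<Inter>?F)" using eq unfolding equiv_def sym_def by blast
    show "trans (\<Inter>?F)" using eq unfolding equiv_def trans_def by blast
  qed
  moreover have "(f xs, f ys) \<in> \<Inter>?F"
    if "(k, f) \<in> ualg_ops A" "length xs = k" "list_all2 (\<lambda>x y. (x, y) \<in> \<Inter>?F) xs ys"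
    for k f xs ys
  proof
    fix \<delta> assume d: "\<delta> \<in> ?F"
    then have "list_all2 (\<lambda>x y. (x, y) \<in> \<delta>) xs ys"
      by (intro list_all2_mono[OF that(3)]) blast
    then show "(f xs, f ys) \<in> \<delta>" using d that(1,2) unfolding ualg_congruence_def by blast
  qed
  ultimately have c: "ualg_congruence A (\<Inter>?F)" unfolding ualg_congruence_def by blast
  have z: "centralizes A \<alpha> \<beta> (\<Inter>?F)"
    unfolding centralizes_def[of A \<alpha> \<beta> "\<Inter>?F"]
  proof (intro allI impI ballI)
    fix n :: nat and t a b c d
    assume h: "1 \<le> n" "t \<in> term_functions A (n + 1)" "a \<in> carrier A" "b \<in> carrier A"
      "length c = n" "length d = n" "set c \<subseteq> carrier A" "set d \<subseteq> carrier A"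
      "(a, b) \<in> \<alpha>" "\<forall>i < n. (c ! i, d ! i) \<in> \<beta>" "(t (a # c), t (a # d)) \<in> \<Inter>?F"
    show "(t (b # c), t (b # d)) \<in> \<Inter>?F"
    proof
      fix \<delta> assume d: "\<delta> \<in> ?F"
      then have "(t (a # c), t (a # d)) \<in> \<delta>" using h(11) by blast
      moreover have "centralizes A \<alpha> \<beta> \<delta>" using d by simp
      ultimately show "(t (b # c), t (b # d)) \<in> \<delta>"
        unfolding centralizes_def using h(1-10) by simp
    qed
  qed
  have comm: "ualg_commutator A \<alpha> \<beta> = \<Inter>?F"
    unfolding ualg_commutator_def
  proof (rule Least_equality)
    show "ualg_congruence A (\<Inter>?F) \<and> centralizes A \<alpha> \<beta> (\<Inter>?F)" using c z by (rule conjI)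
  next
    fix \<delta> assume "ualg_congruence A \<delta> \<and> centralizes A \<alpha> \<beta> \<delta>"
    then show "\<Inter>?F \<subseteq> \<delta>" by (intro Inter_lower CollectI)
  qed
  show "ualg_congruence A (ualg_commutator A \<alpha> \<beta>)" unfolding comm by (rule c)
  show "centralizes A \<alpha> \<beta> (ualg_commutator A \<alpha> \<beta>)" unfolding comm by (rule z)
  show "ualg_commutator A \<alpha> \<beta> \<subseteq> \<delta>"
    if "ualg_congruence A \<delta>" "centralizes A \<alpha> \<beta> \<delta>" for \<delta>
    unfolding comm using that by (intro Inter_lower CollectI conjI)
qed

section \<open>Semigroups\<close>

text \<open>A semigroup is given by a carrier set and a multiplication that is relevant only on it.\<close>

definition semigroup_on :: "'a set \<Rightarrow> ('a \<Rightarrow> 'a \<Rightarrow> 'a) \<Rightarrow> bool" where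
  "semigroup_on S m \<longleftrightarrow> (\<forall>x \<in> S. \<forall>y \<in> S. m x y \<in> S) \<and>
     (\<forall>x \<in> S. \<forall>y \<in> S. \<forall>z \<in> S. m (m x y) z = m x (m y z))"

definition semigroup_alg :: "'a set \<Rightarrow> ('a \<Rightarrow> 'a \<Rightarrow> 'a) \<Rightarrow> 'a ualg" where
  "semigroup_alg S m = \<lparr>carrier = S, ualg_ops = {(2, \<lambda>xs. m (xs ! 0) (xs ! 1))}\<rparr>"

definition regular_semigroup :: "'a set \<Rightarrow> ('a \<Rightarrow> 'a \<Rightarrow> 'a) \<Rightarrow> bool" where
  "regular_semigroup S m \<longleftrightarrow> semigroup_on S m \<and> (\<forall>a \<in> S. \<exists>x \<in> S. m (m a x) a = a)"

definition semigroup_ideal :: "'a set \<Rightarrow> ('a \<Rightarrow> 'a \<Rightarrow> 'a) \<Rightarrow> 'a set \<Rightarrow> bool" where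
  "semigroup_ideal S m I \<longleftrightarrow> I \<noteq> {} \<and> I \<subseteq> S \<and> (\<forall>s \<in> S. \<forall>i \<in> I. m s i \<in> I \<and> m i s \<in> I)"

definition simple_semigroup :: "'a set \<Rightarrow> ('a \<Rightarrow> 'a \<Rightarrow> 'a) \<Rightarrow> bool" where
  "simple_semigroup S m \<longleftrightarrow> semigroup_on S m \<and> \<not> (\<exists>I. semigroup_ideal S m I \<and> I \<noteq> S)"

text \<open>Green's relations: equality of the principal one-sided ideals \<open>S\<^sup>1 a\<close>, \<open>a S\<^sup>1\<close>.\<close>

definition green_L :: "'a set \<Rightarrow> ('a \<Rightarrow> 'a \<Rightarrow> 'a) \<Rightarrow> ('a \<times> 'a) set" where
  "green_L S m = {(a, b). a \<in> S \<and> b \<in> S \<and>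
     insert a ((\<lambda>s. m s a) ` S) = insert b ((\<lambda>s. m s b) ` S)}"

definition green_R :: "'a set \<Rightarrow> ('a \<Rightarrow> 'a \<Rightarrow> 'a) \<Rightarrow> ('a \<times> 'a) set" where
  "green_R S m = {(a, b). a \<in> S \<and> b \<in> S \<and>
     insert a ((\<lambda>s. m a s) ` S) = insert b ((\<lambda>s. m b s) ` S)}"

definition green_H :: "'a set \<Rightarrow> ('a \<Rightarrow> 'a \<Rightarrow> 'a) \<Rightarrow> ('a \<times> 'a) set" where
  "green_H S m = green_L S m \<inter> green_R S m"

section \<open>Groups\<close>

definition group_alg :: "('a, 'b) monoid_scheme \<Rightarrow> 'a ualg" where
  "group_alg G = \<lparr>carrier = carrier G,
     ualg_ops = {(2, \<lambda>xs. xs ! 0 \<otimes>\<^bsub>G\<^esub> xs ! 1), (1, \<lambda>xs. inv\<^bsub>G\<^esub> (xs ! 0)), (0, \<lambda>xs. \<one>\<^bsub>G\<^esub>)}\<rparr>"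

text \<open>
  The subset \<open>X\<close> is a nilpotent (solvable) group under the multiplication \<open>m\<close>. The identity \<open>e\<close> is
  uniquely determined by \<open>X\<close> and \<open>m\<close>, so the existential quantifier merely names it.
\<close>

definition is_nilpotent_group :: "'a set \<Rightarrow> ('a \<Rightarrow> 'a \<Rightarrow> 'a) \<Rightarrow> bool" where
  "is_nilpotent_group X m \<longleftrightarrow>
     (\<exists>e. group \<lparr>carrier = X, monoid.mult = m, one = e\<rparr> \<and>
          ualg_nilpotent (group_alg \<lparr>carrier = X, monoid.mult = m, one = e\<rparr>))"

definition is_solvable_group :: "'a set \<Rightarrow> ('a \<Rightarrow> 'a \<Rightarrow> 'a) \<Rightarrow> bool" where
  "is_solvable_group X m \<longleftrightarrow>
     (\<exists>e. group \<lparr>carrier = X, monoid.mult = m, one = e\<rparr> \<and>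
          ualg_solvable (group_alg \<lparr>carrier = X, monoid.mult = m, one = e\<rparr>))"

lemma semigroup_alg_closed: "semigroup_on S m \<Longrightarrow> ualg_closed (semigroup_alg S m)"
  by (simp add: ualg_closed_def semigroup_alg_def semigroup_on_def subset_iff)

lemma group_alg_closed:
  assumes "group G"
  shows "ualg_closed (group_alg G)"
proof -
  interpret group G by fact
  show ?thesis by (simp add: ualg_closed_def group_alg_def subset_iff)
qed

end

theory Submission
  imports Defs
begin

text \<open>
  The bridge between the two sides is the notion of a completely simple semigroup: a regular
  semigroup in which comparable idempotents are equal. In such a semigroup \<open>e S e\<close> is a group for
  every idempotent \<open>e\<close>, these groups are exactly the \<open>\<H>\<close>-classes, they cover \<open>S\<close>, and \<open>S\<close> is
  simple.

  If the lower central or the derived series of \<open>S\<close> reaches equality, then \<open>S\<close> is completely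
  simple: two comparable idempotents \<open>e \<le> f\<close> cannot be separated by any member of the series,
  because \<open>e e = e f\<close> forces \<open>f e\<close> and \<open>f f\<close> to be related by the next member
  (\<open>series_terminates_imp_primitive\<close>). Conversely, a simple semigroup whose \<open>\<H>\<close>-classes are
  groups is completely simple by a classical argument
  (\<open>simple_union_of_groups_imp_primitive\<close>).

  It remains to compare the series of a completely simple \<open>S\<close> with those of one group
  \<open>G = e S e\<close>. For groups, \<open>\<delta>\<close> absorbs the commutator of \<open>\<alpha>\<close> and \<open>\<beta>\<close> as soon as the classes of
  the identity under \<open>\<alpha>\<close> and \<open>\<beta>\<close> commute modulo \<open>\<delta>\<close>
  (\<open>commute_modulo_imp_centralizes\<close>), and this condition is visible from the semigroup term
  \<open>y x z\<close> alone. Hence the series of \<open>G\<close> lies below the restriction of the series of \<open>S\<close>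
  (\<open>local_series_subset\<close>).

  In the other direction, each congruence \<open>B\<close> of \<open>G\<close> lifts to a congruence of \<open>S\<close> inside \<open>\<H>\<close>,
  which relates \<open>u\<close> and \<open>v\<close> if \<open>e u e\<close> and \<open>e v e\<close> are \<open>B\<close>-related. Equality lifts to equality,
  and centrality lifts too (\<open>lift_centralizes\<close>): evaluating a semigroup term amounts to
  evaluating a product in \<open>G\<close> with additional factors that depend only on the \<open>\<H>\<close>-classes of
  the arguments. Since modulo \<open>\<H>\<close>
  a semigroup term depends only on its first and last variable, \<open>\<H>\<close> contains the commutator of
  the full relation with itself (\<open>green_H_centralizes\<close>). So the series of \<open>S\<close> follows the lift of
  the series of \<open>G\<close> one step behind (\<open>series_subset_lift\<close>), and one series terminates if and only
  if the other does. All arguments are the same for nilpotency and solvability.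
\<close>

section \<open>Term functions and congruences of semigroups and groups\<close>

lemma binary_op_term:
  assumes "(2, \<lambda>xs. m (xs ! 0) (xs ! 1)) \<in> ualg_ops A"
    and "p \<in> term_functions A n" "q \<in> term_functions A n"
  shows "(\<lambda>xs. m (p xs) (q xs)) \<in> term_functions A n"
  using term_functions.comp[OF assms(1), of "[p, q]" n] assms(2,3) by simp

lemma semigroup_term_induct [consumes 1, case_names proj mult]:
  assumes "t \<in> term_functions (semigroup_alg S m) n"
    and "\<And>i. i < n \<Longrightarrow> P (\<lambda>xs. xs ! i)"
    and "\<And>p q. p \<in> term_functions (semigroup_alg S m) n \<Longrightarrow>
           q \<in> term_functions (semigroup_alg S m) n \<Longrightarrow> P p \<Longrightarrow> P q \<Longrightarrow>
           P (\<lambda>xs. m (p xs) (q xs))"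
  shows "P t"
  using assms(1)
proof induction
  case (proj i)
  then show ?case by (rule assms(2))
next
  case (comp k f ts)
  then have f: "f = (\<lambda>xs. m (xs ! 0) (xs ! 1))" and "length ts = 2"
    by (auto simp: semigroup_alg_def)
  then obtain p q where "ts = [p, q]"
    by (auto simp: numeral_2_eq_2 length_Suc_conv)
  then show ?case using comp.IH assms(3)[of p q] by (simp add: f)
qed

lemma group_term_induct [consumes 1, case_names proj mult inv one]:
  fixes G (structure)
  assumes "t \<in> term_functions (group_alg G) n"
    and "\<And>i. i < n \<Longrightarrow> P (\<lambda>xs. xs ! i)"
    and "\<And>p q. P p \<Longrightarrow> P q \<Longrightarrow> P (\<lambda>xs. p xs \<otimes> q xs)"
    and "\<And>p. P p \<Longrightarrow> P (\<lambda>xs. inv (p xs))"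
    and "P (\<lambda>xs. \<one>)"
  shows "P t"
  using assms(1)
proof induction
  case (proj i)
  then show ?case by (rule assms(2))
next
  case (comp k f ts)
  then consider "f = (\<lambda>xs. xs ! 0 \<otimes> xs ! 1)" "length ts = 2"
    | "f = (\<lambda>xs. inv (xs ! 0))" "length ts = 1" | "f = (\<lambda>xs. \<one>)"
    by (auto simp: group_alg_def)
  then show ?case
  proof cases
    case 1
    then obtain p q where "ts = [p, q]"
      by (auto simp: numeral_2_eq_2 length_Suc_conv)
    then show ?thesis using comp.IH assms(3)[of p q] by (simp add: 1)
  next
    case 2
    then obtain p where "ts = [p]"
      by (auto simp: length_Suc_conv)
    then show ?thesis using comp.IH assms(4)[of p] by (simp add: 2)
  next
    case 3
    then show ?thesis using assms(5) by simp
  qed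
qed

lemma semigroup_congruence_iff:
  "ualg_congruence (semigroup_alg S m) \<theta> \<longleftrightarrow>
     equiv S \<theta> \<and> (\<forall>x y u v. (x, y) \<in> \<theta> \<longrightarrow> (u, v) \<in> \<theta> \<longrightarrow> (m x u, m y v) \<in> \<theta>)"
  (is "?L \<longleftrightarrow> ?R")
proof
  assume L: ?L
  have "(m x u, m y v) \<in> \<theta>" if "(x, y) \<in> \<theta>" "(u, v) \<in> \<theta>" for x y u v
  proof -
    have "\<forall>xs ys. length xs = 2 \<longrightarrow> list_all2 (\<lambda>x y. (x, y) \<in> \<theta>) xs ys \<longrightarrow>
        (m (xs ! 0) (xs ! 1), m (ys ! 0) (ys ! 1)) \<in> \<theta>"
      using L unfolding ualg_congruence_def semigroup_alg_def by simp
    from this[rule_format, of "[x, u]" "[y, v]"] show ?thesis using that by simp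
  qed
  then show ?R using L by (simp add: ualg_congruence_def semigroup_alg_def)
next
  assume ?R
  then show ?L
    by (auto simp: ualg_congruence_def semigroup_alg_def list_all2_conv_all_nth)
qed

text \<open>
  Compatibility with inverses is automatic, since \<open>x\<^sup>-\<^sup>1 = x\<^sup>-\<^sup>1 y y\<^sup>-\<^sup>1\<close> and \<open>y\<^sup>-\<^sup>1 = x\<^sup>-\<^sup>1 x y\<^sup>-\<^sup>1\<close>.
\<close>

lemma (in group) group_congruence_iff:
  "ualg_congruence (group_alg G) \<theta> \<longleftrightarrow> equiv (carrier G) \<theta> \<and>
     (\<forall>x y u v. (x, y) \<in> \<theta> \<longrightarrow> (u, v) \<in> \<theta> \<longrightarrow> (x \<otimes> u, y \<otimes> v) \<in> \<theta>)"
  (is "?L \<longleftrightarrow> ?R")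
proof
  assume L: ?L
  have "(x \<otimes> u, y \<otimes> v) \<in> \<theta>" if "(x, y) \<in> \<theta>" "(u, v) \<in> \<theta>" for x y u v
  proof -
    have "\<forall>xs ys. length xs = 2 \<longrightarrow> list_all2 (\<lambda>x y. (x, y) \<in> \<theta>) xs ys \<longrightarrow>
        (xs ! 0 \<otimes> xs ! 1, ys ! 0 \<otimes> ys ! 1) \<in> \<theta>"
      using L unfolding ualg_congruence_def group_alg_def by simp
    from this[rule_format, of "[x, u]" "[y, v]"] show ?thesis using that by simp
  qed
  then show ?R using L by (simp add: ualg_congruence_def group_alg_def)
next
  assume R: ?R
  then have eq: "equiv (carrier G) \<theta>" and
    mult: "\<And>x y u v. (x, y) \<in> \<theta> \<Longrightarrow> (u, v) \<in> \<theta> \<Longrightarrow> (x \<otimes> u, y \<otimes> v) \<in> \<theta>" by blast+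
  have "(inv x, inv y) \<in> \<theta>" if xy: "(x, y) \<in> \<theta>" for x y
  proof -
    have c: "x \<in> carrier G" "y \<in> carrier G"
      using xy equiv_type[OF eq] by blast+
    have "(inv x, inv x) \<in> \<theta>" "(inv y, inv y) \<in> \<theta>"
      using eq c by (auto simp: equiv_def refl_on_def)
    then have "(inv x \<otimes> x \<otimes> inv y, inv x \<otimes> y \<otimes> inv y) \<in> \<theta>"
      using mult xy by blast
    then have "(inv y, inv x) \<in> \<theta>" using c by (simp add: m_assoc)
    then show ?thesis using eq by (auto simp: equiv_def sym_def)
  qed
  then show ?L using R
    by (auto simp: ualg_congruence_def group_alg_def list_all2_conv_all_nth
        equiv_def refl_on_def)
qed

lemma term_function_respects_congruence:
  assumes "ualg_congruence A \<theta>" and "t \<in> term_functions A n"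
    and "length xs = n" "list_all2 (\<lambda>x y. (x, y) \<in> \<theta>) xs ys"
  shows "(t xs, t ys) \<in> \<theta>"
  using assms(2)
proof induction
  case (proj i)
  then show ?case using assms(3,4) by (simp add: list_all2_conv_all_nth)
next
  case (comp k f ts)
  have "list_all2 (\<lambda>x y. (x, y) \<in> \<theta>) (map (\<lambda>t. t xs) ts) (map (\<lambda>t. t ys) ts)"
    using comp.IH by (simp add: list_all2_conv_all_nth)
  then show ?case
    using comp.hyps assms(1) unfolding ualg_congruence_def by fastforce
qed

lemma ualg_congruenceD:
  assumes "ualg_congruence A \<theta>"
  shows "\<theta> \<subseteq> carrier A \<times> carrier A" "x \<in> carrier A \<Longrightarrow> (x, x) \<in> \<theta>"
    "(x, y) \<in> \<theta> \<Longrightarrow> (y, x) \<in> \<theta>" "(x, y) \<in> \<theta> \<Longrightarrow> (y, z) \<in> \<theta> \<Longrightarrow> (x, z) \<in> \<theta>"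
  using assms unfolding ualg_congruence_def equiv_def refl_on_def sym_def trans_def
  by blast+

section \<open>Centrality and the two series\<close>

lemma centralizes_antimono:
  assumes "centralizes A \<alpha>' \<beta>' \<delta>" "\<alpha> \<subseteq> \<alpha>'" "\<beta> \<subseteq> \<beta>'"
  shows "centralizes A \<alpha> \<beta> \<delta>"
  unfolding centralizes_def
proof (intro allI impI ballI)
  fix n t a b c d
  assume h: "1 \<le> n" "t \<in> term_functions A (n + 1)" "a \<in> carrier A" "b \<in> carrier A"
    "length c = n" "length d = n" "set c \<subseteq> carrier A" "set d \<subseteq> carrier A"
    "(a, b) \<in> \<alpha>" "\<forall>i < n. (c ! i, d ! i) \<in> \<beta>" "(t (a # c), t (a # d)) \<in> \<delta>"
  have "(a, b) \<in> \<alpha>'" "\<forall>i < n. (c ! i, d ! i) \<in> \<beta>'" using h(9,10) assms(2,3) by blast+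
  then show "(t (b # c), t (b # d)) \<in> \<delta>"
    using assms(1) h(1-8,11) unfolding centralizes_def by simp
qed

text \<open>
  Comparing the term \<open>y x z\<close> at \<open>(y, z) = (b, e)\<close> and \<open>(y, z) = (e, b)\<close> turns centrality into
  commutation: the two values agree for \<open>x = e\<close> and are \<open>b a\<close> and \<open>a b\<close> for \<open>x = a\<close>. The term
  uses multiplication only, so the lemma serves for a group and for a subgroup of a semigroup.
\<close>

lemma centralizes_imp_commute:
  assumes op: "(2, \<lambda>xs. m (xs ! 0) (xs ! 1)) \<in> ualg_ops A"
    and C: "centralizes A \<alpha> \<beta> \<delta>"
    and c: "e \<in> carrier A" "a \<in> carrier A" "b \<in> carrier A"
    and r: "(e, a) \<in> \<alpha>" "(b, e) \<in> \<beta>" "(e, b) \<in> \<beta>" "(b, b) \<in> \<delta>"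
    and unit: "m e e = e" "m e a = a" "m (m b a) e = m b a" "m e b = b" "m b e = b"
  shows "(m b a, m a b) \<in> \<delta>"
proof -
  let ?t = "\<lambda>xs. m (m (xs ! 1) (xs ! 0)) (xs ! 2)"
  have t: "?t \<in> term_functions A (2 + 1)"
    by (intro binary_op_term[OF op] term_functions.proj) simp_all
  have "(?t (e # [b, e]), ?t (e # [e, b])) \<in> \<delta>"
    using r(4) unit by simp
  moreover have "\<forall>i < 2. ([b, e] ! i, [e, b] ! i) \<in> \<beta>"
    using r by (simp add: less_2_cases_iff)
  moreover have "length [b, e] = 2" "length [e, b] = 2" "(1::nat) \<le> 2"
    "set [b, e] \<subseteq> carrier A" "set [e, b] \<subseteq> carrier A" using c by auto
  ultimately have "(?t (a # [b, e]), ?t (a # [e, b])) \<in> \<delta>"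
    using C[unfolded centralizes_def, rule_format, OF _ t c(1) c(2) _ _ _ _ r(1)] by blast
  then show ?thesis using unit by simp
qed

text \<open>
  The flag chooses between the two series, the lower central series from the full relation for
  \<open>True\<close> and the derived series for \<open>False\<close>, so that nilpotency and solvability can be treated
  by a single argument.
\<close>

primrec commutator_series :: "bool \<Rightarrow> ('a, 'b) ualg_scheme \<Rightarrow> nat \<Rightarrow> ('a \<times> 'a) set" where
  "commutator_series c A 0 = one_cong A"
| "commutator_series c A (Suc k) =
     ualg_commutator A (if c then one_cong A else commutator_series c A k)
       (commutator_series c A k)"

definition series_terminates :: "bool \<Rightarrow> ('a, 'b) ualg_scheme \<Rightarrow> bool" where
  "series_terminates c A \<longleftrightarrow> (\<exists>n \<ge> 1. commutator_series c A n = zero_cong A)"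

lemma ualg_nilpotent_iff: "ualg_nilpotent A \<longleftrightarrow> series_terminates True A"
proof -
  have "central_series A (one_cong A) (one_cong A) k = commutator_series True A k" for k
    by (induction k) simp_all
  then show ?thesis
    by (simp add: ualg_nilpotent_def ualg_n_nilpotent_def series_terminates_def)
qed

lemma ualg_solvable_iff: "ualg_solvable A \<longleftrightarrow> series_terminates False A"
proof -
  have "derived_series A (one_cong A) k = commutator_series False A k" for k
    by (induction k) simp_all
  then show ?thesis
    by (simp add: ualg_solvable_def ualg_n_solvable_def series_terminates_def)
qed

lemma commutator_series_congruence:
  assumes "ualg_closed A"
  shows "ualg_congruence A (commutator_series c A k)"
  by (cases k) (simp_all add: one_cong_congruence ualg_commutator_least(1) assms)

lemma commutator_series_centralizes:
  assumes "ualg_closed A"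
  shows "centralizes A (if c then one_cong A else commutator_series c A k)
    (commutator_series c A k) (commutator_series c A (Suc k))"
  by (simp only: commutator_series.simps ualg_commutator_least(2)[OF assms])

lemma commutator_series_Suc_subset:
  assumes "ualg_closed A" "ualg_congruence A \<delta>"
    and "centralizes A \<alpha> \<beta> \<delta>"
    and "(if c then one_cong A else commutator_series c A k) \<subseteq> \<alpha>"
    and "commutator_series c A k \<subseteq> \<beta>"
  shows "commutator_series c A (Suc k) \<subseteq> \<delta>"
  using ualg_commutator_least(3)[OF assms(1,2) centralizes_antimono[OF assms(3-5)]] by simp

section \<open>Centrality in groups\<close>

text \<open>
  For the normal subgroups \<open>A\<close>, \<open>B\<close>, \<open>N\<close> belonging to \<open>\<alpha>\<close>, \<open>\<beta>\<close>, \<open>\<delta>\<close>, this is the classical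
  condition \<open>[A, B] \<le> N\<close>.
\<close>

definition commute_modulo ::
  "('a, 'b) monoid_scheme \<Rightarrow> ('a \<times> 'a) set \<Rightarrow> ('a \<times> 'a) set \<Rightarrow> ('a \<times> 'a) set \<Rightarrow> bool" where
  "commute_modulo G \<alpha> \<beta> \<delta> \<longleftrightarrow> (\<forall>a b. (\<one>\<^bsub>G\<^esub>, a) \<in> \<alpha> \<longrightarrow> (\<one>\<^bsub>G\<^esub>, b) \<in> \<beta> \<longrightarrow>
     (b \<otimes>\<^bsub>G\<^esub> a, a \<otimes>\<^bsub>G\<^esub> b) \<in> \<delta>)"

text \<open>
  This is an invariant of matrices with rows \<open>(t(a,c), t(a,d))\<close> and \<open>(t(b,c), t(b,d))\<close>. Unlike
  the implication in the definition of centrality, equality of the two row quotients modulo \<open>\<delta>\<close>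
  passes through an induction on the term \<open>t\<close>.
\<close>

definition row_quotients_agree ::
  "('a, 'b) monoid_scheme \<Rightarrow> ('a \<times> 'a) set \<Rightarrow> ('a \<times> 'a) set \<Rightarrow> ('a \<times> 'a) set \<Rightarrow>
     'a \<Rightarrow> 'a \<Rightarrow> 'a \<Rightarrow> 'a \<Rightarrow> bool" where
  "row_quotients_agree G \<alpha> \<beta> \<delta> x x' y y' \<longleftrightarrow> (x, x') \<in> \<beta> \<and> (y, y') \<in> \<beta> \<and> (x, y) \<in> \<alpha> \<and>
     (inv\<^bsub>G\<^esub> x \<otimes>\<^bsub>G\<^esub> x', inv\<^bsub>G\<^esub> y \<otimes>\<^bsub>G\<^esub> y') \<in> \<delta>"

locale group_congruences = group +
  fixes \<alpha> \<beta> \<delta>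
  assumes cong: "ualg_congruence (group_alg G) \<alpha>" "ualg_congruence (group_alg G) \<beta>"
      "ualg_congruence (group_alg G) \<delta>"
    and commute: "commute_modulo G \<alpha> \<beta> \<delta>"
begin

lemma group_congruenceD:
  assumes "ualg_congruence (group_alg G) \<theta>"
  shows "(x, y) \<in> \<theta> \<Longrightarrow> x \<in> carrier G" "(x, y) \<in> \<theta> \<Longrightarrow> y \<in> carrier G"
    "x \<in> carrier G \<Longrightarrow> (x, x) \<in> \<theta>"
    "(x, y) \<in> \<theta> \<Longrightarrow> (y, x) \<in> \<theta>" "(x, y) \<in> \<theta> \<Longrightarrow> (y, z) \<in> \<theta> \<Longrightarrow> (x, z) \<in> \<theta>"
    "(x, y) \<in> \<theta> \<Longrightarrow> (u, v) \<in> \<theta> \<Longrightarrow> (x \<otimes> u, y \<otimes> v) \<in> \<theta>"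
    "(x, y) \<in> \<theta> \<Longrightarrow> (inv x, inv y) \<in> \<theta>"
proof -
  have c: "carrier (group_alg G) = carrier G" by (simp add: group_alg_def)
  note D = ualg_congruenceD[OF assms, unfolded c]
  show "(x, y) \<in> \<theta> \<Longrightarrow> x \<in> carrier G" "(x, y) \<in> \<theta> \<Longrightarrow> y \<in> carrier G"
    "x \<in> carrier G \<Longrightarrow> (x, x) \<in> \<theta>"
    "(x, y) \<in> \<theta> \<Longrightarrow> (y, x) \<in> \<theta>" "(x, y) \<in> \<theta> \<Longrightarrow> (y, z) \<in> \<theta> \<Longrightarrow> (x, z) \<in> \<theta>"
    using D by blast+
  show "(x, y) \<in> \<theta> \<Longrightarrow> (u, v) \<in> \<theta> \<Longrightarrow> (x \<otimes> u, y \<otimes> v) \<in> \<theta>"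
    using assms group_congruence_iff by blast
  show "(inv x, inv y) \<in> \<theta>" if "(x, y) \<in> \<theta>"
  proof -
    have "(\<lambda>xs. inv (xs ! 0)) \<in> term_functions (group_alg G) 1"
      using term_functions.comp[of 1 "\<lambda>xs. inv (xs ! 0)" "group_alg G" "[\<lambda>xs. xs ! 0]" 1]
      by (simp add: group_alg_def term_functions.proj)
    from term_function_respects_congruence[OF assms this, of "[x]" "[y]"] that
    show ?thesis by simp
  qed
qed

text \<open>
  Writing \<open>g' = s g\<close>, conjugation by \<open>g\<close> and by \<open>g'\<close> differ by conjugation by \<open>s\<close>, which is
  \<open>\<alpha>\<close>-related to the identity and so commutes with \<open>z'\<close> modulo \<open>\<delta>\<close>.
\<close>

lemma conjugates_agree:
  assumes z: "(\<one>, z) \<in> \<beta>" "(\<one>, z') \<in> \<beta>" "(z, z') \<in> \<delta>" and g: "(g, g') \<in> \<alpha>"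
  shows "(inv g \<otimes> z \<otimes> g, inv g' \<otimes> z' \<otimes> g') \<in> \<delta>"
proof -
  note A = group_congruenceD[OF cong(1)] and B = group_congruenceD[OF cong(2)]
    and D = group_congruenceD[OF cong(3)]
  have c: "z \<in> carrier G" "z' \<in> carrier G" "g \<in> carrier G" "g' \<in> carrier G"
    using z g A(1,2) B(1,2) by blast+
  define s where "s = g' \<otimes> inv g"
  have sc: "s \<in> carrier G" using c by (simp add: s_def)
  have "(g \<otimes> inv g, g' \<otimes> inv g) \<in> \<alpha>" using g c by (intro A(6)[OF _ A(3)]) simp_all
  then have "(\<one>, s) \<in> \<alpha>" using c by (simp add: s_def)
  then have "(z' \<otimes> s, s \<otimes> z') \<in> \<delta>"
    using z(2) commute by (simp add: commute_modulo_def)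
  then have "(inv g' \<otimes> (z' \<otimes> s) \<otimes> g, inv g' \<otimes> (s \<otimes> z') \<otimes> g) \<in> \<delta>"
    using c by (intro D(6)[OF D(6)[OF D(3)] D(3)]) simp_all
  moreover have "s \<otimes> g = g'" "inv g' \<otimes> s = inv g"
    using c by (simp_all add: s_def m_assoc, simp add: m_assoc[symmetric])
  then have "inv g' \<otimes> (z' \<otimes> s) \<otimes> g = inv g' \<otimes> z' \<otimes> g'"
    "inv g' \<otimes> (s \<otimes> z') \<otimes> g = inv g \<otimes> z' \<otimes> g"
    using c sc by (simp_all add: m_assoc, simp add: m_assoc[symmetric])
  ultimately have "(inv g' \<otimes> z' \<otimes> g', inv g \<otimes> z' \<otimes> g) \<in> \<delta>" by simp
  moreover have "(inv g \<otimes> z \<otimes> g, inv g \<otimes> z' \<otimes> g) \<in> \<delta>"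
    using c z(3) by (intro D(6)[OF D(6)[OF D(3)] D(3)]) simp_all
  ultimately show ?thesis using D(4,5) by blast
qed

abbreviation agree where "agree \<equiv> row_quotients_agree G \<alpha> \<beta> \<delta>"

lemma agree_carrier:
  assumes "agree x x' y y'"
  shows "x \<in> carrier G" "x' \<in> carrier G" "y \<in> carrier G" "y' \<in> carrier G"
  using assms group_congruenceD(1,2)[OF cong(2)] by (auto simp: row_quotients_agree_def)

lemma agree_quotient:
  assumes "agree x x' y y'"
  shows "(\<one>, inv x \<otimes> x') \<in> \<beta>" "(\<one>, inv y \<otimes> y') \<in> \<beta>"
proof -
  have *: "(\<one>, inv u \<otimes> v) \<in> \<beta>" if "(u, v) \<in> \<beta>" for u v
  proof -
    note B = group_congruenceD[OF cong(2)]
    have c: "u \<in> carrier G" using that B(1) by blast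
    then have "(inv u \<otimes> u, inv u \<otimes> v) \<in> \<beta>" using that by (intro B(6)[OF B(3)]) simp_all
    then show ?thesis using c by simp
  qed
  show "(\<one>, inv x \<otimes> x') \<in> \<beta>" "(\<one>, inv y \<otimes> y') \<in> \<beta>"
    using assms * by (auto simp: row_quotients_agree_def)
qed

text \<open>
  The quotient of a product is \<open>(x u)\<^sup>-\<^sup>1 (x' u') = (u\<^sup>-\<^sup>1 (x\<^sup>-\<^sup>1 x') u) (u\<^sup>-\<^sup>1 u')\<close>: a conjugate of the
  first quotient times the second quotient.
\<close>

lemma agree_mult:
  assumes p: "agree x x' y y'" and q: "agree u u' v v'"
  shows "agree (x \<otimes> u) (x' \<otimes> u') (y \<otimes> v) (y' \<otimes> v')"
proof -
  note A = group_congruenceD[OF cong(1)] and B = group_congruenceD[OF cong(2)]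
    and D = group_congruenceD[OF cong(3)]
  note c = agree_carrier[OF p] agree_carrier[OF q]
  have "(inv u \<otimes> (inv x \<otimes> x') \<otimes> u, inv v \<otimes> (inv y \<otimes> y') \<otimes> v) \<in> \<delta>"
    using p q agree_quotient[OF p] by (intro conjugates_agree) (auto simp: row_quotients_agree_def)
  then have "(inv u \<otimes> (inv x \<otimes> x') \<otimes> u \<otimes> (inv u \<otimes> u'),
      inv v \<otimes> (inv y \<otimes> y') \<otimes> v \<otimes> (inv v \<otimes> v')) \<in> \<delta>"
    using q D(6) by (auto simp: row_quotients_agree_def)
  moreover have "inv a \<otimes> (inv b \<otimes> b') \<otimes> a \<otimes> (inv a \<otimes> a') = inv (b \<otimes> a) \<otimes> (b' \<otimes> a')"
    if "a \<in> carrier G" "b \<in> carrier G" "a' \<in> carrier G" "b' \<in> carrier G" for a b a' b'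
  proof -
    have "a \<otimes> (inv a \<otimes> a') = a'" using that by (simp add: m_assoc[symmetric])
    then show ?thesis using that by (simp add: m_assoc inv_mult_group)
  qed
  ultimately show ?thesis
    using p q A(6) B(6) c unfolding row_quotients_agree_def by simp
qed

text \<open>
  The quotient of inverses, \<open>x x'\<^sup>-\<^sup>1\<close>, is the conjugate of \<open>(x\<^sup>-\<^sup>1 x')\<^sup>-\<^sup>1\<close> by \<open>x\<^sup>-\<^sup>1\<close>.
\<close>

lemma agree_inv:
  assumes p: "agree x x' y y'"
  shows "agree (inv x) (inv x') (inv y) (inv y')"
proof -
  note A = group_congruenceD[OF cong(1)] and B = group_congruenceD[OF cong(2)]
    and D = group_congruenceD[OF cong(3)]
  note c = agree_carrier[OF p]
  have 1: "(\<one>, inv (inv x \<otimes> x')) \<in> \<beta>" "(\<one>, inv (inv y \<otimes> y')) \<in> \<beta>"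
    using agree_quotient[OF p] B(7) by fastforce+
  have 2: "(inv (inv x \<otimes> x'), inv (inv y \<otimes> y')) \<in> \<delta>"
    using p D(7) by (auto simp: row_quotients_agree_def)
  have 3: "(inv x, inv y) \<in> \<alpha>" using p A(7) by (auto simp: row_quotients_agree_def)
  have "inv (inv a) \<otimes> inv (inv a \<otimes> a') \<otimes> inv a = inv (inv a) \<otimes> inv a'"
    if "a \<in> carrier G" "a' \<in> carrier G" for a a'
    using that by (simp add: m_assoc inv_mult_group)
  then show ?thesis using conjugates_agree[OF 1 2 3] c 3 p B(7)
    unfolding row_quotients_agree_def by simp
qed

lemma agree_const_rows: "(x, y) \<in> \<alpha> \<Longrightarrow> agree x x y y"
  using group_congruenceD[OF cong(1)] group_congruenceD[OF cong(2)] group_congruenceD[OF cong(3)]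
  unfolding row_quotients_agree_def by (metis l_inv one_closed)

lemma agree_const_columns: "(x, x') \<in> \<beta> \<Longrightarrow> agree x x' x x'"
  using group_congruenceD[OF cong(1)] group_congruenceD[OF cong(2)] group_congruenceD[OF cong(3)]
  unfolding row_quotients_agree_def by (metis m_closed inv_closed)

lemma agree_imp_related:
  assumes "agree x x' y y'" "(x, x') \<in> \<delta>"
  shows "(y, y') \<in> \<delta>"
proof -
  note D = group_congruenceD[OF cong(3)]
  note c = agree_carrier[OF assms(1)]
  have "(inv x \<otimes> x, inv x \<otimes> x') \<in> \<delta>" using c assms(2) by (intro D(6)[OF D(3)]) simp_all
  then have "(\<one>, inv y \<otimes> y') \<in> \<delta>"
    using c assms(1) D(5) by (simp add: row_quotients_agree_def)
  then have "(y \<otimes> \<one>, y \<otimes> (inv y \<otimes> y')) \<in> \<delta>" using c by (intro D(6)[OF D(3)]) simp_all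
  moreover have "y \<otimes> (inv y \<otimes> y') = y'" using c by (simp add: m_assoc[symmetric])
  ultimately show ?thesis using c by simp
qed

text \<open>
  By induction on the term, the row quotients agree: this holds for the matrices of the variables,
  which have constant rows or constant columns, and it is preserved by the group operations.
\<close>

theorem commute_modulo_imp_centralizes: "centralizes (group_alg G) \<alpha> \<beta> \<delta>"
  unfolding centralizes_def
proof (intro allI impI ballI)
  fix n t a b c d
  assume h: "1 \<le> n" "t \<in> term_functions (group_alg G) (n + 1)"
    "length c = n" "length d = n"
    "(a, b) \<in> \<alpha>" "\<forall>i < n. (c ! i, d ! i) \<in> \<beta>" "(t (a # c), t (a # d)) \<in> \<delta>"
  have "agree (t (a # c)) (t (a # d)) (t (b # c)) (t (b # d))"
    using h(2)
  proof (induction rule: group_term_induct)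
    case (proj i)
    then show ?case using h by (cases i) (auto intro: agree_const_rows agree_const_columns)
  next
    case one
    then show ?case by (intro agree_const_rows group_congruenceD(3)[OF cong(1)]) simp
  qed (auto intro: agree_mult agree_inv)
  then show "(t (b # c), t (b # d)) \<in> \<delta>" using h(7) by (rule agree_imp_related)
qed

end

lemma (in group) centralizes_imp_commute_modulo:
  assumes "ualg_congruence (group_alg G) \<beta>" "ualg_congruence (group_alg G) \<delta>"
    and \<alpha>: "\<alpha> \<subseteq> carrier G \<times> carrier G" and C: "centralizes (group_alg G) \<alpha> \<beta> \<delta>"
  shows "commute_modulo G \<alpha> \<beta> \<delta>"
  unfolding commute_modulo_def
proof (intro allI impI)
  fix a b assume ab: "(\<one>, a) \<in> \<alpha>" "(\<one>, b) \<in> \<beta>"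
  have G: "carrier (group_alg G) = carrier G" by (simp add: group_alg_def)
  note B = ualg_congruenceD[OF assms(1), unfolded G]
    and D = ualg_congruenceD[OF assms(2), unfolded G]
  have c: "a \<in> carrier G" "b \<in> carrier G" using ab \<alpha> B(1) by blast+
  show "(b \<otimes> a, a \<otimes> b) \<in> \<delta>"
    by (rule centralizes_imp_commute[OF _ C, where e = \<one>])
      (use ab c B(2) B(3)[OF ab(2)] D(2) in \<open>simp_all add: group_alg_def\<close>)
qed

section \<open>Completely simple semigroups\<close>

text \<open>
  Completely simple semigroups are often introduced as simple semigroups with a primitive
  idempotent. For nonempty regular semigroups it is equivalent that all idempotents are primitive, and this
  form is what the commutator condition delivers directly.
\<close>

locale completely_simple =
  fixes S :: "'a set" and m :: "'a \<Rightarrow> 'a \<Rightarrow> 'a" (infixl "\<cdot>" 70)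
  assumes regular: "regular_semigroup S (\<cdot>)"
    and primitive: "\<lbrakk>e \<in> S; f \<in> S; e \<cdot> e = e; f \<cdot> f = f; e \<cdot> f = e; f \<cdot> e = e\<rbrakk> \<Longrightarrow> e = f"
begin

lemma semigroup: "semigroup_on S (\<cdot>)"
  using regular by (simp add: regular_semigroup_def)

lemma closed [simp]: "x \<in> S \<Longrightarrow> y \<in> S \<Longrightarrow> x \<cdot> y \<in> S"
  using semigroup by (simp add: semigroup_on_def)

lemma assoc: "x \<in> S \<Longrightarrow> y \<in> S \<Longrightarrow> z \<in> S \<Longrightarrow> x \<cdot> y \<cdot> z = x \<cdot> (y \<cdot> z)"
  using semigroup by (simp add: semigroup_on_def)

lemma left_assoc: "x \<in> S \<Longrightarrow> y \<in> S \<Longrightarrow> z \<in> S \<Longrightarrow> x \<cdot> (y \<cdot> z) = x \<cdot> y \<cdot> z"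
  by (simp add: assoc)

definition idempotent :: "'a \<Rightarrow> bool" where
  "idempotent e \<longleftrightarrow> e \<in> S \<and> e \<cdot> e = e"

lemma idempotentD [dest, simp]: "idempotent e \<Longrightarrow> e \<in> S" "idempotent e \<Longrightarrow> e \<cdot> e = e"
  by (simp_all add: idempotent_def)

text \<open>
  The carrier is \<open>e S e\<close>, described as the set of elements fixed by \<open>e\<close> on both sides.
\<close>

definition local_group :: "'a \<Rightarrow> 'a monoid" where
  "local_group e = \<lparr>carrier = {a \<in> S. e \<cdot> a = a \<and> a \<cdot> e = a}, monoid.mult = (\<cdot>), one = e\<rparr>"

lemma local_group_simps [simp]:
  "x \<in> carrier (local_group e) \<longleftrightarrow> x \<in> S \<and> e \<cdot> x = x \<and> x \<cdot> e = x"
  "monoid.mult (local_group e) = (\<cdot>)" "one (local_group e) = e"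
  by (auto simp: local_group_def)

text \<open>
  If \<open>x = x y x\<close>, then \<open>e y x\<close> is an idempotent below \<open>e\<close>. Hence it equals \<open>e\<close>, and \<open>e y e\<close> is a
  left inverse of \<open>x\<close>.
\<close>

lemma local_group:
  assumes e: "idempotent e"
  shows "group (local_group e)"
proof (rule groupI)
  fix x assume x: "x \<in> carrier (local_group e)"
  then obtain y where y: "y \<in> S" "x \<cdot> y \<cdot> x = x"
    using regular by (auto simp: regular_semigroup_def)
  let ?h = "e \<cdot> y \<cdot> x"
  have c: "e \<in> S" "x \<in> S" "e \<cdot> x = x" "x \<cdot> e = x" "e \<cdot> e = e" using e x by auto
  have xyx: "x \<cdot> (y \<cdot> x) = x" using y c by (simp add: assoc)
  have xez: "x \<cdot> (e \<cdot> z) = x \<cdot> z" "e \<cdot> (e \<cdot> z) = e \<cdot> z" if "z \<in> S" for z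
    using c that by (simp_all add: left_assoc)
  have "?h \<cdot> ?h = ?h" "?h \<cdot> e = ?h" "e \<cdot> ?h = ?h"
    using c y by (simp_all add: assoc xyx xez)
  with c y have "?h = e" by - (rule primitive, simp_all)
  then have "(e \<cdot> y \<cdot> e) \<cdot> x = e" using c y by (simp add: assoc)
  moreover have "e \<cdot> y \<cdot> e \<in> carrier (local_group e)"
    using c y by (simp add: assoc xez)
  ultimately show "\<exists>z\<in>carrier (local_group e). z \<otimes>\<^bsub>local_group e\<^esub> x = \<one>\<^bsub>local_group e\<^esub>"
    unfolding local_group_simps(2,3) by blast
next
  fix x y assume "x \<in> carrier (local_group e)" "y \<in> carrier (local_group e)"
  then have x: "x \<in> S" "e \<cdot> x = x" "x \<cdot> e = x" and y: "y \<in> S" "e \<cdot> y = y" "y \<cdot> e = y" by auto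
  have "e \<cdot> (x \<cdot> y) = e \<cdot> x \<cdot> y" "x \<cdot> y \<cdot> e = x \<cdot> (y \<cdot> e)"
    using x(1) y(1) e by (simp_all only: assoc idempotentD(1))
  then show "x \<otimes>\<^bsub>local_group e\<^esub> y \<in> carrier (local_group e)" using x y by simp
qed (use e in \<open>auto simp: assoc\<close>)

lemma sandwich_closed:
  assumes "idempotent e" "x \<in> S"
  shows "e \<cdot> x \<cdot> e \<in> carrier (local_group e)"
proof -
  have "e \<in> S" "e \<cdot> e = e" using assms by auto
  moreover have "e \<cdot> (e \<cdot> x \<cdot> e) = e \<cdot> e \<cdot> x \<cdot> e"
    using assms by (simp only: assoc closed idempotentD(1))
  moreover have "e \<cdot> x \<cdot> e \<cdot> e = e \<cdot> x \<cdot> (e \<cdot> e)"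
    using assms by (simp only: assoc closed idempotentD(1))
  ultimately show ?thesis using assms by simp
qed

lemma sandwich_inverse:
  assumes e: "idempotent e" and x: "x \<in> S"
  obtains z where "z \<in> carrier (local_group e)" "z \<cdot> (e \<cdot> x \<cdot> e) = e" "e \<cdot> x \<cdot> e \<cdot> z = e"
proof -
  interpret G: group "local_group e" using e by (rule local_group)
  note c = sandwich_closed[OF e x]
  show ?thesis
    using that[OF G.inv_closed[OF c]] G.l_inv[OF c] G.r_inv[OF c]
    unfolding local_group_simps(2,3) by blast
qed

text \<open>
  For \<open>a = a x a\<close>, invertibility in the local groups at \<open>a x\<close> and \<open>x a\<close> yields \<open>u\<close> and \<open>v\<close> with
  \<open>a = a a u = v a a\<close>. Then \<open>a u = v a a u = v a\<close> is the idempotent required.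
\<close>

lemma in_local_group:
  assumes a: "a \<in> S"
  obtains g where "idempotent g" "a \<in> carrier (local_group g)"
proof -
  obtain x where x: "x \<in> S" "a \<cdot> x \<cdot> a = a"
    using regular a by (auto simp: regular_semigroup_def)
  let ?e = "a \<cdot> x" and ?f = "x \<cdot> a"
  have e: "idempotent ?e" and f: "idempotent ?f"
  proof -
    have "?e \<cdot> ?e = a \<cdot> x \<cdot> a \<cdot> x" "?f \<cdot> ?f = x \<cdot> (a \<cdot> x \<cdot> a)"
      using x(1) a by (simp_all only: assoc closed)
    then show "idempotent ?e" "idempotent ?f" unfolding idempotent_def using x a by simp_all
  qed
  have ea: "?e \<cdot> a = a" and af: "a \<cdot> ?f = a" using x a by (simp_all add: assoc)
  obtain y where y: "y \<in> S" "?e \<cdot> a \<cdot> ?e \<cdot> y = ?e"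
    using sandwich_inverse[OF e a] by auto
  obtain z where z: "z \<in> S" "z \<cdot> (?f \<cdot> a \<cdot> ?f) = ?f"
    using sandwich_inverse[OF f a] by auto
  define u where "u = x \<cdot> y \<cdot> a"
  define v where "v = a \<cdot> z \<cdot> x"
  have uv: "u \<in> S" "v \<in> S" using x y z a by (simp_all add: u_def v_def)
  have "a = ?e \<cdot> a \<cdot> ?e \<cdot> y \<cdot> a" unfolding y(2) by (simp only: ea)
  also have "\<dots> = a \<cdot> ?e \<cdot> y \<cdot> a" by (simp only: ea)
  also have "\<dots> = a \<cdot> a \<cdot> u" unfolding u_def using x(1) y(1) a by (simp only: assoc closed)
  finally have u: "a \<cdot> a \<cdot> u = a" by simp
  have "a = a \<cdot> (z \<cdot> (?f \<cdot> a \<cdot> ?f))" unfolding z(2) by (simp only: af)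
  also have "?f \<cdot> a \<cdot> ?f = ?f \<cdot> a" using x a af by (simp add: assoc)
  also have "a \<cdot> (z \<cdot> (?f \<cdot> a)) = v \<cdot> (a \<cdot> a)" using x z a by (simp add: v_def assoc)
  finally have v: "v \<cdot> (a \<cdot> a) = a" by simp
  define g where "g = a \<cdot> u"
  have g: "g = v \<cdot> a"
  proof -
    have "v \<cdot> a = v \<cdot> (a \<cdot> a \<cdot> u)" by (simp add: u)
    also have "\<dots> = v \<cdot> (a \<cdot> a) \<cdot> u" using uv a by (simp add: assoc)
    finally show ?thesis by (simp add: v g_def)
  qed
  have ga: "g \<cdot> a = a" unfolding g using uv a v by (simp add: assoc)
  have ag: "a \<cdot> g = a" unfolding g_def using uv a u by (simp add: assoc)
  have gS: "g \<in> S" using uv a by (simp add: g_def)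
  have "g \<cdot> g = g \<cdot> a \<cdot> u" using uv a gS by (simp add: g_def assoc)
  then have "idempotent g" unfolding idempotent_def using gS ga g_def by simp
  then show ?thesis using that[of g] a ga ag by simp
qed

lemma simple: "simple_semigroup S (\<cdot>)"
  unfolding simple_semigroup_def
proof (intro conjI notI semigroup)
  assume "\<exists>I. semigroup_ideal S (\<cdot>) I \<and> I \<noteq> S"
  then obtain I where "semigroup_ideal S (\<cdot>) I" "I \<noteq> S" by blast
  moreover from this obtain s where s: "s \<in> I" by (auto simp: semigroup_ideal_def)
  ultimately have I: "\<And>s i. s \<in> S \<Longrightarrow> i \<in> I \<Longrightarrow> s \<cdot> i \<in> I \<and> i \<cdot> s \<in> I"
    and "I \<subseteq> S" "I \<noteq> S" by (simp_all add: semigroup_ideal_def)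
  then obtain a where a: "a \<in> S" "a \<notin> I" by blast
  obtain g where g: "idempotent g" "a \<in> carrier (local_group g)"
    using in_local_group a by blast
  obtain z where z: "z \<in> S" "g \<cdot> s \<cdot> g \<cdot> z = g"
    using sandwich_inverse[OF g(1), of s] s \<open>I \<subseteq> S\<close> by auto
  have gS: "g \<in> S" using g by simp
  have "g \<cdot> s \<cdot> g \<cdot> z \<cdot> a \<in> I"
    using I[OF gS s] I[OF gS, of "g \<cdot> s"] I[OF z(1), of "g \<cdot> s \<cdot> g"] I[OF a(1)] by blast
  then show False using g a z(2) by simp
qed

subsection \<open>Green's relations\<close>

lemma green_R_iff:
  "(a, b) \<in> green_R S (\<cdot>) \<longleftrightarrow>
     a \<in> S \<and> b \<in> S \<and> (\<exists>x\<in>S. b = a \<cdot> x) \<and> (\<exists>x\<in>S. a = b \<cdot> x)"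
proof -
  have idl: "insert c ((\<lambda>s. c \<cdot> s) ` S) = (\<lambda>s. c \<cdot> s) ` S" if "c \<in> S" for c
  proof -
    obtain g where "idempotent g" "c \<in> carrier (local_group g)"
      using in_local_group \<open>c \<in> S\<close> by blast
    then have "c = c \<cdot> g" "g \<in> S" by auto
    then show ?thesis by blast
  qed
  have sub: "(\<lambda>s. c \<cdot> s) ` S \<subseteq> (\<lambda>s. d \<cdot> s) ` S \<longleftrightarrow> (\<exists>x\<in>S. c = d \<cdot> x)"
    if "c \<in> S" "d \<in> S" for c d
  proof
    assume "(\<lambda>s. c \<cdot> s) ` S \<subseteq> (\<lambda>s. d \<cdot> s) ` S"
    then have "c \<in> (\<lambda>s. d \<cdot> s) ` S" using idl[OF that(1)] by blast
    then show "\<exists>x\<in>S. c = d \<cdot> x" by blast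
  next
    assume "\<exists>x\<in>S. c = d \<cdot> x"
    then show "(\<lambda>s. c \<cdot> s) ` S \<subseteq> (\<lambda>s. d \<cdot> s) ` S" using that by (auto simp: assoc)
  qed
  have "insert a ((\<lambda>s. a \<cdot> s) ` S) = insert b ((\<lambda>s. b \<cdot> s) ` S) \<longleftrightarrow> (\<lambda>s. b \<cdot> s) ` S \<subseteq> (\<lambda>s. a \<cdot> s) ` S \<and> (\<lambda>s. a \<cdot> s) ` S \<subseteq> (\<lambda>s. b \<cdot> s) ` S"
    if "a \<in> S" "b \<in> S" using that by (simp only: idl) blast
  then show ?thesis using sub unfolding green_R_def by auto
qed

lemma green_L_iff:
  "(a, b) \<in> green_L S (\<cdot>) \<longleftrightarrow>
     a \<in> S \<and> b \<in> S \<and> (\<exists>x\<in>S. b = x \<cdot> a) \<and> (\<exists>x\<in>S. a = x \<cdot> b)"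
proof -
  have idl: "insert c ((\<lambda>s. s \<cdot> c) ` S) = (\<lambda>s. s \<cdot> c) ` S" if "c \<in> S" for c
  proof -
    obtain g where "idempotent g" "c \<in> carrier (local_group g)"
      using in_local_group \<open>c \<in> S\<close> by blast
    then have "c = g \<cdot> c" "g \<in> S" by auto
    then show ?thesis by blast
  qed
  have sub: "(\<lambda>s. s \<cdot> c) ` S \<subseteq> (\<lambda>s. s \<cdot> d) ` S \<longleftrightarrow> (\<exists>x\<in>S. c = x \<cdot> d)"
    if "c \<in> S" "d \<in> S" for c d
  proof
    assume "(\<lambda>s. s \<cdot> c) ` S \<subseteq> (\<lambda>s. s \<cdot> d) ` S"
    then have "c \<in> (\<lambda>s. s \<cdot> d) ` S" using idl[OF that(1)] by blast
    then show "\<exists>x\<in>S. c = x \<cdot> d" by blast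
  next
    assume "\<exists>x\<in>S. c = x \<cdot> d"
    then show "(\<lambda>s. s \<cdot> c) ` S \<subseteq> (\<lambda>s. s \<cdot> d) ` S" using that by (auto simp: left_assoc)
  qed
  have "insert a ((\<lambda>s. s \<cdot> a) ` S) = insert b ((\<lambda>s. s \<cdot> b) ` S) \<longleftrightarrow> (\<lambda>s. s \<cdot> b) ` S \<subseteq> (\<lambda>s. s \<cdot> a) ` S \<and> (\<lambda>s. s \<cdot> a) ` S \<subseteq> (\<lambda>s. s \<cdot> b) ` S"
    if "a \<in> S" "b \<in> S" using that by (simp only: idl) blast
  then show ?thesis using sub unfolding green_L_def by auto
qed

lemma equiv_green: "equiv S (green_R S (\<cdot>))" "equiv S (green_L S (\<cdot>))" "equiv S (green_H S (\<cdot>))"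
  by (auto simp: green_H_def green_R_def green_L_def equiv_def refl_on_def sym_def trans_def)

text \<open>
  If \<open>a\<close> lies in the local group at \<open>g\<close>, then \<open>g a b g\<close> is invertible there; so \<open>g\<close>, and with it
  \<open>a = g a\<close>, is a right multiple of \<open>a b\<close>.
\<close>

lemma mult_green_R:
  assumes "a \<in> S" "b \<in> S"
  shows "(a \<cdot> b, a) \<in> green_R S (\<cdot>)"
proof -
  obtain g where g: "idempotent g" "a \<in> carrier (local_group g)"
    using in_local_group assms by blast
  obtain z where z: "z \<in> S" "g \<cdot> (a \<cdot> b) \<cdot> g \<cdot> z = g"
    using sandwich_inverse[OF g(1), of "a \<cdot> b"] assms by auto
  have "a = g \<cdot> (a \<cdot> b) \<cdot> g \<cdot> z \<cdot> a" using z g by simp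
  also have "g \<cdot> (a \<cdot> b) = a \<cdot> b" using g assms by (simp add: left_assoc idempotentD(1))
  also have "a \<cdot> b \<cdot> g \<cdot> z \<cdot> a = a \<cdot> b \<cdot> (g \<cdot> z \<cdot> a)" using z g assms by (simp add: assoc)
  finally have "a = a \<cdot> b \<cdot> (g \<cdot> z \<cdot> a)" .
  moreover have "g \<cdot> z \<cdot> a \<in> S" using z g assms by simp
  ultimately show ?thesis using assms by (auto simp: green_R_iff)
qed

lemma mult_green_L:
  assumes "a \<in> S" "b \<in> S"
  shows "(a \<cdot> b, b) \<in> green_L S (\<cdot>)"
proof -
  obtain g where g: "idempotent g" "b \<in> carrier (local_group g)"
    using in_local_group assms by blast
  obtain z where z: "z \<in> S" "z \<cdot> (g \<cdot> (a \<cdot> b) \<cdot> g) = g"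
    using sandwich_inverse[OF g(1), of "a \<cdot> b"] assms by auto
  have "b = b \<cdot> (z \<cdot> (g \<cdot> (a \<cdot> b) \<cdot> g))" using z g by simp
  also have "g \<cdot> (a \<cdot> b) \<cdot> g = g \<cdot> (a \<cdot> b)" using g assms by (simp add: assoc idempotentD(1))
  also have "b \<cdot> (z \<cdot> (g \<cdot> (a \<cdot> b))) = b \<cdot> z \<cdot> g \<cdot> (a \<cdot> b)"
    using z g assms by (simp add: assoc)
  finally have "b = b \<cdot> z \<cdot> g \<cdot> (a \<cdot> b)" .
  moreover have "b \<cdot> z \<cdot> g \<in> S" using z g assms by simp
  ultimately show ?thesis using assms by (auto simp: green_L_iff)
qed

text \<open>
  This is immediate from \<open>x u \<R> x \<R> y \<R> y v\<close> and \<open>x u \<L> u \<L> v \<L> y v\<close>.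
\<close>

lemma green_H_congruence: "ualg_congruence (semigroup_alg S (\<cdot>)) (green_H S (\<cdot>))"
  unfolding semigroup_congruence_iff
proof (intro conjI allI impI equiv_green)
  fix x y u v assume xy: "(x, y) \<in> green_H S (\<cdot>)" and uv: "(u, v) \<in> green_H S (\<cdot>)"
  have c: "x \<in> S" "y \<in> S" "u \<in> S" "v \<in> S"
    using xy uv by (auto simp: green_H_def green_R_iff)
  have "(x \<cdot> u, y \<cdot> v) \<in> green_R S (\<cdot>)"
    using mult_green_R[OF c(1,3)] mult_green_R[OF c(2,4)] xy
    by (auto simp: green_H_def green_R_def)
  moreover have "(x \<cdot> u, y \<cdot> v) \<in> green_L S (\<cdot>)"
    using mult_green_L[OF c(1,3)] mult_green_L[OF c(2,4)] uv
    by (auto simp: green_H_def green_L_def)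
  ultimately show "(x \<cdot> u, y \<cdot> v) \<in> green_H S (\<cdot>)" by (simp add: green_H_def)
qed

lemma green_H_class:
  assumes e: "idempotent e"
  shows "green_H S (\<cdot>) `` {e} = carrier (local_group e)"
proof
  interpret G: group "local_group e" using e by (rule local_group)
  show "green_H S (\<cdot>) `` {e} \<subseteq> carrier (local_group e)"
  proof
    fix b assume "b \<in> green_H S (\<cdot>) `` {e}"
    then obtain x y where b: "b \<in> S" and x: "x \<in> S" "b = e \<cdot> x" and y: "y \<in> S" "b = y \<cdot> e"
      by (auto simp: green_H_def green_R_iff green_L_iff)
    have "e \<cdot> (e \<cdot> x) = e \<cdot> e \<cdot> x" "y \<cdot> e \<cdot> e = y \<cdot> (e \<cdot> e)"
      using e x(1) y(1) by (simp_all only: assoc idempotentD(1))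
    then have "e \<cdot> b = b" "b \<cdot> e = b" using e x(2) y(2) by simp_all
    then show "b \<in> carrier (local_group e)" using b by simp
  qed
  show "carrier (local_group e) \<subseteq> green_H S (\<cdot>) `` {e}"
  proof
    fix b assume b: "b \<in> carrier (local_group e)"
    then have "e = b \<cdot> inv\<^bsub>local_group e\<^esub> b" "e = inv\<^bsub>local_group e\<^esub> b \<cdot> b"
      using G.r_inv G.l_inv by (metis local_group_simps(2,3))+
    moreover have "inv\<^bsub>local_group e\<^esub> b \<in> S" using G.inv_closed[OF b] by simp
    moreover have "b = e \<cdot> b" "b = b \<cdot> e" "b \<in> S" using b by auto
    ultimately have "(e, b) \<in> green_H S (\<cdot>)"
      using e unfolding green_H_def Int_iff green_R_iff green_L_iff by blast
    then show "b \<in> green_H S (\<cdot>) `` {e}" by simp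
  qed
qed

lemma green_H_classes: "S // green_H S (\<cdot>) = {carrier (local_group e) |e. idempotent e}"
proof
  show "S // green_H S (\<cdot>) \<subseteq> {carrier (local_group e) |e. idempotent e}"
  proof
    fix X assume "X \<in> S // green_H S (\<cdot>)"
    then obtain a where a: "a \<in> S" "X = green_H S (\<cdot>) `` {a}" by (rule quotientE)
    obtain g where g: "idempotent g" "a \<in> carrier (local_group g)"
      using in_local_group a by blast
    then have "(g, a) \<in> green_H S (\<cdot>)" using green_H_class by blast
    then have "X = green_H S (\<cdot>) `` {g}"
      using a equiv_class_eq[OF equiv_green(3)] by metis
    then show "X \<in> {carrier (local_group e) |e. idempotent e}"
      using g green_H_class by blast
  qed
next
  show "{carrier (local_group e) |e. idempotent e} \<subseteq> S // green_H S (\<cdot>)"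
  proof clarify
    fix e assume "idempotent e"
    then show "carrier (local_group e) \<in> S // green_H S (\<cdot>)"
      using green_H_class[of e] quotientI[of e S "green_H S (\<cdot>)"] by auto
  qed
qed

lemma local_group_identity_unique:
  assumes e: "idempotent e"
    and "group \<lparr>carrier = carrier (local_group e), monoid.mult = (\<cdot>), one = e'\<rparr>"
  shows "e' = e"
proof -
  interpret G: group "\<lparr>carrier = carrier (local_group e), monoid.mult = (\<cdot>), one = e'\<rparr>"
    by fact
  have "e' \<cdot> e = e'" using G.one_closed by simp
  moreover have "e' \<cdot> e = e" using G.l_one[of e] e by simp
  ultimately show ?thesis by simp
qed


section \<open>Commutators in completely simple semigroups\<close>

lemma semigroup_alg_carrier [simp]: "carrier (semigroup_alg S (\<cdot>)) = S"
  by (simp add: semigroup_alg_def)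

lemma group_alg_local_group_carrier [simp]:
  "carrier (group_alg (local_group e)) = carrier (local_group e)"
  by (simp add: group_alg_def)

lemma semigroup_term_closed:
  assumes "t \<in> term_functions (semigroup_alg S (\<cdot>)) n" "length xs = n" "set xs \<subseteq> S"
  shows "t xs \<in> S"
  using term_functions_closed[OF semigroup_alg_closed[OF semigroup] assms(1,2)] assms(3) by simp

text \<open>
  Modulo \<open>\<R>\<close> a product equals its first factor, so a term depends only on its first variable;
  dually for \<open>\<L>\<close> and the last variable.
\<close>

lemma term_green_R_variable:
  assumes "t \<in> term_functions (semigroup_alg S (\<cdot>)) n"
  shows "\<exists>i < n. \<forall>xs. length xs = n \<longrightarrow> set xs \<subseteq> S \<longrightarrow> (t xs, xs ! i) \<in> green_R S (\<cdot>)"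
  using assms
proof (induction rule: semigroup_term_induct)
  case (proj i)
  have "(xs ! i, xs ! i) \<in> green_R S (\<cdot>)" if "length xs = n" "set xs \<subseteq> S" for xs
    using equiv_green(1) proj that nth_mem unfolding equiv_def refl_on_def by blast
  then show ?case using proj by blast
next
  case (mult p q)
  then obtain i where i: "i < n"
    "\<And>xs. length xs = n \<Longrightarrow> set xs \<subseteq> S \<Longrightarrow> (p xs, xs ! i) \<in> green_R S (\<cdot>)" by blast
  have "(p xs \<cdot> q xs, xs ! i) \<in> green_R S (\<cdot>)" if "length xs = n" "set xs \<subseteq> S" for xs
    using equiv_green(1) i(2)[OF that] mult_green_R semigroup_term_closed mult.hyps that
    unfolding equiv_def trans_def by blast
  then show ?case using i(1) by blast
qed

lemma term_green_L_variable:
  assumes "t \<in> term_functions (semigroup_alg S (\<cdot>)) n"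
  shows "\<exists>i < n. \<forall>xs. length xs = n \<longrightarrow> set xs \<subseteq> S \<longrightarrow> (t xs, xs ! i) \<in> green_L S (\<cdot>)"
  using assms
proof (induction rule: semigroup_term_induct)
  case (proj i)
  have "(xs ! i, xs ! i) \<in> green_L S (\<cdot>)" if "length xs = n" "set xs \<subseteq> S" for xs
    using equiv_green(2) proj that nth_mem unfolding equiv_def refl_on_def by blast
  then show ?case using proj by blast
next
  case (mult p q)
  then obtain i where i: "i < n"
    "\<And>xs. length xs = n \<Longrightarrow> set xs \<subseteq> S \<Longrightarrow> (q xs, xs ! i) \<in> green_L S (\<cdot>)" by blast
  have "(p xs \<cdot> q xs, xs ! i) \<in> green_L S (\<cdot>)" if "length xs = n" "set xs \<subseteq> S" for xs
    using equiv_green(2) i(2)[OF that] mult_green_L semigroup_term_closed mult.hyps that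
    unfolding equiv_def trans_def by blast
  then show ?case using i(1) by blast
qed

text \<open>
  If \<open>t\<close> is a projection modulo \<open>\<theta>\<close>, either it selects the distinguished variable, and both
  values in the second row are \<open>\<theta>\<close>-related to \<open>b\<close>, or it selects another one, and the two rows
  coincide modulo \<open>\<theta>\<close>.
\<close>

lemma variable_dependent_centralizes:
  assumes \<theta>: "equiv S \<theta>"
    and "i < n + 1"
    and t: "\<And>xs. length xs = n + 1 \<Longrightarrow> set xs \<subseteq> S \<Longrightarrow> (t xs, xs ! i) \<in> \<theta>"
    and S: "a \<in> S" "b \<in> S" "set c \<subseteq> S" "set d \<subseteq> S" "length c = n" "length d = n"
    and acd: "(t (a # c), t (a # d)) \<in> \<theta>"
  shows "(t (b # c), t (b # d)) \<in> \<theta>"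
proof -
  have 1: "(t (a # c), (a # c) ! i) \<in> \<theta>" "(t (a # d), (a # d) ! i) \<in> \<theta>"
    "(t (b # c), (b # c) ! i) \<in> \<theta>" "(t (b # d), (b # d) ! i) \<in> \<theta>"
    using S by (simp_all add: t)
  have sym: "\<And>x y. (x, y) \<in> \<theta> \<Longrightarrow> (y, x) \<in> \<theta>"
    and trans: "\<And>x y z. (x, y) \<in> \<theta> \<Longrightarrow> (y, z) \<in> \<theta> \<Longrightarrow> (x, z) \<in> \<theta>"
    using \<theta> unfolding equiv_def sym_def trans_def by blast+
  show ?thesis
  proof (cases i)
    case 0
    then show ?thesis using 1(3,4) trans sym by (metis nth_Cons_0)
  next
    case (Suc j)
    then have "(c ! j, d ! j) \<in> \<theta>" using 1(1,2) acd trans sym by (metis nth_Cons_Suc)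
    then show ?thesis using 1(3,4) Suc trans sym by (metis nth_Cons_Suc)
  qed
qed

lemma green_H_centralizes: "centralizes (semigroup_alg S (\<cdot>)) \<alpha> \<beta> (green_H S (\<cdot>))"
  unfolding centralizes_def semigroup_alg_carrier
proof (intro allI impI ballI)
  fix n t a b c d
  assume h: "t \<in> term_functions (semigroup_alg S (\<cdot>)) (n + 1)" "a \<in> S" "b \<in> S"
    "length c = n" "length d = n" "set c \<subseteq> S" "set d \<subseteq> S"
    "(t (a # c), t (a # d)) \<in> green_H S (\<cdot>)"
  obtain i where i: "i < n + 1"
    "\<And>xs. length xs = n + 1 \<Longrightarrow> set xs \<subseteq> S \<Longrightarrow> (t xs, xs ! i) \<in> green_R S (\<cdot>)"
    using term_green_R_variable[OF h(1)] by blast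
  have "(t (b # c), t (b # d)) \<in> green_R S (\<cdot>)"
    by (rule variable_dependent_centralizes[OF equiv_green(1) i h(2,3,6,7,4,5)])
      (use h(8) in \<open>simp_all add: green_H_def\<close>)
  moreover
  obtain i where i: "i < n + 1"
    "\<And>xs. length xs = n + 1 \<Longrightarrow> set xs \<subseteq> S \<Longrightarrow> (t xs, xs ! i) \<in> green_L S (\<cdot>)"
    using term_green_L_variable[OF h(1)] by blast
  have "(t (b # c), t (b # d)) \<in> green_L S (\<cdot>)"
    by (rule variable_dependent_centralizes[OF equiv_green(2) i h(2,3,6,7,4,5)])
      (use h(8) in \<open>simp_all add: green_H_def\<close>)
  ultimately show "(t (b # c), t (b # d)) \<in> green_H S (\<cdot>)" by (simp add: green_H_def)
qed

text \<open>
  Multiplication by \<open>e\<close> from the left can be undone uniformly on an \<open>\<R>\<close>-class: if \<open>g\<close> is the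
  identity of the local group of \<open>u\<close> and \<open>z\<close> the inverse of \<open>g e g\<close> there, then
  \<open>z e u = z g e g u = g u = u\<close>. The other members of the class are right multiples of \<open>u\<close>.
\<close>

lemma green_R_recover:
  assumes e: "idempotent e" and uv: "(u, v) \<in> green_R S (\<cdot>)"
  obtains y where "y \<in> S" "u = y \<cdot> e \<cdot> u" "v = y \<cdot> e \<cdot> v"
proof -
  have c: "e \<in> S" "u \<in> S" using uv e by (auto simp: green_R_iff)
  obtain x where x: "x \<in> S" "v = u \<cdot> x" using uv by (auto simp: green_R_iff)
  obtain g where g: "idempotent g" "u \<in> carrier (local_group g)"
    using in_local_group c by blast
  have gu: "g \<in> S" "g \<cdot> u = u" using g by auto
  obtain z where z: "z \<in> carrier (local_group g)" "z \<cdot> (g \<cdot> e \<cdot> g) = g"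
    using sandwich_inverse[OF g(1) c(1)] by blast
  have zS: "z \<in> S" using z by simp
  have "u = z \<cdot> (g \<cdot> e \<cdot> g) \<cdot> u" unfolding z(2) using gu by simp
  also have "\<dots> = z \<cdot> g \<cdot> e \<cdot> (g \<cdot> u)" using zS gu(1) c by (simp only: assoc closed)
  also have "\<dots> = z \<cdot> e \<cdot> u" using z gu by simp
  finally have u: "u = z \<cdot> e \<cdot> u" .
  have "v = z \<cdot> e \<cdot> u \<cdot> x" using u x by simp
  also have "\<dots> = z \<cdot> e \<cdot> v" unfolding x(2) using zS c x(1) by (simp only: assoc closed)
  finally show ?thesis using that[OF zS u] by blast
qed

lemma green_L_recover:
  assumes e: "idempotent e" and uv: "(u, v) \<in> green_L S (\<cdot>)"
  obtains y where "y \<in> S" "u = u \<cdot> (e \<cdot> y)" "v = v \<cdot> (e \<cdot> y)"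
proof -
  have c: "e \<in> S" "u \<in> S" using uv e by (auto simp: green_L_iff)
  obtain x where x: "x \<in> S" "v = x \<cdot> u" using uv by (auto simp: green_L_iff)
  obtain g where g: "idempotent g" "u \<in> carrier (local_group g)"
    using in_local_group c by blast
  have gu: "g \<in> S" "u \<cdot> g = u" using g by auto
  obtain z where z: "z \<in> carrier (local_group g)" "(g \<cdot> e \<cdot> g) \<cdot> z = g"
    using sandwich_inverse[OF g(1) c(1)] by blast
  have zS: "z \<in> S" using z by simp
  have "u = u \<cdot> (g \<cdot> e \<cdot> g \<cdot> z)" unfolding z(2) using gu by simp
  also have "\<dots> = u \<cdot> g \<cdot> (e \<cdot> (g \<cdot> z))" using zS gu(1) c by (simp only: assoc closed)
  also have "\<dots> = u \<cdot> (e \<cdot> z)" using z gu by simp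
  finally have u: "u = u \<cdot> (e \<cdot> z)" .
  have "v = x \<cdot> (u \<cdot> (e \<cdot> z))" using u x by simp
  also have "\<dots> = v \<cdot> (e \<cdot> z)" unfolding x(2) using zS c x(1) by (simp only: assoc closed)
  finally show ?thesis using that[OF zS u] by blast
qed

text \<open>
  The map \<open>p \<mapsto> e p e\<close> is not a homomorphism, but it is one up to a correction factor \<open>w\<close>, which
  is constant as long as \<open>p\<close> stays in its \<open>\<L>\<close>-class and \<open>q\<close> in its \<open>\<R>\<close>-class. These factors
  correspond to the entries of the sandwich matrix in a Rees matrix representation.
\<close>

lemma sandwich_mult:
  assumes e: "idempotent e" and p: "(p, p') \<in> green_L S (\<cdot>)" and q: "(q, q') \<in> green_R S (\<cdot>)"
  obtains w where "w \<in> carrier (local_group e)"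
    "e \<cdot> (p \<cdot> q) \<cdot> e = (e \<cdot> p \<cdot> e) \<cdot> w \<cdot> (e \<cdot> q \<cdot> e)"
    "e \<cdot> (p' \<cdot> q') \<cdot> e = (e \<cdot> p' \<cdot> e) \<cdot> w \<cdot> (e \<cdot> q' \<cdot> e)"
proof -
  obtain x where x: "x \<in> S" "p = p \<cdot> (e \<cdot> x)" "p' = p' \<cdot> (e \<cdot> x)"
    using green_L_recover[OF e p] .
  obtain y where y: "y \<in> S" "q = y \<cdot> e \<cdot> q" "q' = y \<cdot> e \<cdot> q'"
    using green_R_recover[OF e q] .
  have eS: "e \<in> S" using e by simp
  have *: "e \<cdot> (r \<cdot> s) \<cdot> e = (e \<cdot> r \<cdot> e) \<cdot> (e \<cdot> (x \<cdot> y) \<cdot> e) \<cdot> (e \<cdot> s \<cdot> e)"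
    if "r \<in> S" "s \<in> S" and r: "r = r \<cdot> (e \<cdot> x)" and s: "s = y \<cdot> e \<cdot> s" for r s
  proof -
    have "e \<cdot> (r \<cdot> s) \<cdot> e = e \<cdot> (r \<cdot> (e \<cdot> x) \<cdot> (y \<cdot> e \<cdot> s)) \<cdot> e" using r s by simp
    also have "\<dots> = (e \<cdot> r \<cdot> e) \<cdot> (x \<cdot> y) \<cdot> (e \<cdot> s \<cdot> e)"
      using that(1,2) x(1) y(1) eS by (simp only: assoc closed)
    also have "\<dots> = (e \<cdot> r \<cdot> (e \<cdot> e)) \<cdot> (x \<cdot> y) \<cdot> ((e \<cdot> e) \<cdot> s \<cdot> e)" using e by simp
    also have "\<dots> = (e \<cdot> r \<cdot> e) \<cdot> (e \<cdot> (x \<cdot> y) \<cdot> e) \<cdot> (e \<cdot> s \<cdot> e)"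
      using that(1,2) x(1) y(1) eS by (simp only: assoc closed)
    finally show ?thesis .
  qed
  have "p \<in> S" "p' \<in> S" "q \<in> S" "q' \<in> S" using p q by (auto simp: green_L_iff green_R_iff)
  then show ?thesis
    using that[OF sandwich_closed[OF e, of "x \<cdot> y"]] * x y by simp
qed

definition lift_congruence :: "'a \<Rightarrow> ('a \<times> 'a) set \<Rightarrow> ('a \<times> 'a) set" where
  "lift_congruence e B = {(u, v) \<in> green_H S (\<cdot>). (e \<cdot> u \<cdot> e, e \<cdot> v \<cdot> e) \<in> B}"

definition restrict_congruence :: "'a \<Rightarrow> ('a \<times> 'a) set \<Rightarrow> ('a \<times> 'a) set" where
  "restrict_congruence e \<theta> = \<theta> \<inter> carrier (local_group e) \<times> carrier (local_group e)"

lemma restrict_is_congruence: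
  assumes e: "idempotent e" and \<theta>: "ualg_congruence (semigroup_alg S (\<cdot>)) \<theta>"
  shows "ualg_congruence (group_alg (local_group e)) (restrict_congruence e \<theta>)"
proof -
  interpret G: group "local_group e" using e by (rule local_group)
  have mult: "\<And>x y u v. (x, y) \<in> \<theta> \<Longrightarrow> (u, v) \<in> \<theta> \<Longrightarrow> (x \<cdot> u, y \<cdot> v) \<in> \<theta>" and eq: "equiv S \<theta>"
    using \<theta> by (auto simp: semigroup_congruence_iff)
  have sub: "carrier (local_group e) \<subseteq> S" by auto
  have "equiv (carrier (local_group e)) (restrict_congruence e \<theta>)"
    using eq sub unfolding restrict_congruence_def equiv_def refl_on_def sym_def trans_def by blast
  moreover have "(x \<cdot> u, y \<cdot> v) \<in> restrict_congruence e \<theta>"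
    if "(x, y) \<in> restrict_congruence e \<theta>" "(u, v) \<in> restrict_congruence e \<theta>" for x y u v
  proof -
    have "x \<cdot> u \<in> carrier (local_group e)" "y \<cdot> v \<in> carrier (local_group e)"
      using G.m_closed[of x u] G.m_closed[of y v] that
      unfolding local_group_simps(2) restrict_congruence_def by blast+
    then show ?thesis using that mult unfolding restrict_congruence_def by blast
  qed
  ultimately show ?thesis unfolding G.group_congruence_iff local_group_simps(2) by blast
qed

lemma lift_is_congruence:
  assumes e: "idempotent e" and B: "ualg_congruence (group_alg (local_group e)) B"
  shows "ualg_congruence (semigroup_alg S (\<cdot>)) (lift_congruence e B)"
proof -
  interpret G: group "local_group e" using e by (rule local_group)
  have mult: "\<And>x y u v. (x, y) \<in> B \<Longrightarrow> (u, v) \<in> B \<Longrightarrow> (x \<cdot> u, y \<cdot> v) \<in> B"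
    and eq: "equiv (carrier (local_group e)) B"
    using B by (auto simp: G.group_congruence_iff)
  note D = ualg_congruenceD[OF B, unfolded group_alg_local_group_carrier]
  note H = ualg_congruenceD[OF green_H_congruence, unfolded semigroup_alg_carrier]
  have "equiv S (lift_congruence e B)"
  proof (rule equivI)
    show "lift_congruence e B \<subseteq> S \<times> S" using H(1) by (auto simp: lift_congruence_def)
    show "refl_on S (lift_congruence e B)"
      using D(2)[OF sandwich_closed[OF e]] H(2) by (auto simp: refl_on_def lift_congruence_def)
    show "sym (lift_congruence e B)"
      using D(3) H(3) by (auto simp: sym_def lift_congruence_def)
    show "trans (lift_congruence e B)"
      using D(4) H(4) unfolding trans_def lift_congruence_def by blast
  qed
  moreover have "(p \<cdot> q, p' \<cdot> q') \<in> lift_congruence e B"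
    if p: "(p, p') \<in> lift_congruence e B" and q: "(q, q') \<in> lift_congruence e B" for p p' q q'
  proof -
    have "(p, p') \<in> green_L S (\<cdot>)" "(q, q') \<in> green_R S (\<cdot>)"
      using p q by (auto simp: lift_congruence_def green_H_def)
    then obtain w where w: "w \<in> carrier (local_group e)"
      "e \<cdot> (p \<cdot> q) \<cdot> e = (e \<cdot> p \<cdot> e) \<cdot> w \<cdot> (e \<cdot> q \<cdot> e)"
      "e \<cdot> (p' \<cdot> q') \<cdot> e = (e \<cdot> p' \<cdot> e) \<cdot> w \<cdot> (e \<cdot> q' \<cdot> e)"
      by (rule sandwich_mult[OF e])
    have "((e \<cdot> p \<cdot> e) \<cdot> w \<cdot> (e \<cdot> q \<cdot> e), (e \<cdot> p' \<cdot> e) \<cdot> w \<cdot> (e \<cdot> q' \<cdot> e)) \<in> B"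
      using p q D(2)[OF w(1)] mult unfolding lift_congruence_def by blast
    moreover have "(p \<cdot> q, p' \<cdot> q') \<in> green_H S (\<cdot>)"
      using p q green_H_congruence unfolding semigroup_congruence_iff lift_congruence_def by blast
    ultimately show ?thesis unfolding lift_congruence_def w(2,3)[symmetric] by blast
  qed
  ultimately show ?thesis unfolding semigroup_congruence_iff by blast
qed

lemma restrict_lift:
  assumes "(x, y) \<in> restrict_congruence e (lift_congruence e B)"
  shows "(x, y) \<in> B"
  using assms by (auto simp: restrict_congruence_def lift_congruence_def)

text \<open>
  An element of a given \<open>\<H>\<close>-class is determined by \<open>e u e\<close>, because multiplication by \<open>e\<close> can be
  undone on both sides.
\<close>

lemma lift_zero:
  assumes e: "idempotent e"
  shows "lift_congruence e (zero_cong (group_alg (local_group e))) \<subseteq> zero_cong (semigroup_alg S (\<cdot>))"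
proof
  fix z assume "z \<in> lift_congruence e (zero_cong (group_alg (local_group e)))"
  then obtain u v where z: "z = (u, v)" and h: "(u, v) \<in> green_H S (\<cdot>)" "e \<cdot> u \<cdot> e = e \<cdot> v \<cdot> e"
    by (auto simp: lift_congruence_def zero_cong_def)
  have c: "e \<in> S" "u \<in> S" "v \<in> S" using e h by (auto simp: green_H_def green_R_iff)
  obtain x where x: "x \<in> S" "u = u \<cdot> (e \<cdot> x)" "v = v \<cdot> (e \<cdot> x)"
    using green_L_recover[OF e] h unfolding green_H_def by blast
  obtain y where y: "y \<in> S" "u = y \<cdot> e \<cdot> u" "v = y \<cdot> e \<cdot> v"
    using green_R_recover[OF e] h unfolding green_H_def by blast
  have "r = y \<cdot> (e \<cdot> r \<cdot> e) \<cdot> x" if "r \<in> S" "r = r \<cdot> (e \<cdot> x)" "r = y \<cdot> e \<cdot> r" for r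
  proof -
    have "r = y \<cdot> e \<cdot> (r \<cdot> (e \<cdot> x))" using that(2,3) by simp
    also have "\<dots> = y \<cdot> (e \<cdot> r \<cdot> e) \<cdot> x" using that(1) c x(1) y(1) by (simp only: assoc closed)
    finally show ?thesis .
  qed
  then have "u = v" using x y c h(2) by metis
  then show "z \<in> zero_cong (semigroup_alg S (\<cdot>))" using c by (auto simp: z zero_cong_def)
qed

text \<open>
  The row quotient invariant is applied in \<open>G = e S e\<close> to the matrices of values \<open>e t e\<close>. A product
  \<open>p q\<close> contributes \<open>(e p e) w (e q e)\<close>. Along a row the values stay in their \<open>\<H>\<close>-classes, so
  \<open>w\<close> is the same for both entries of the row. The factors of the two rows are \<open>\<alpha>\<close>-related,
  because \<open>w = (e p e)\<^sup>-\<^sup>1 (e p q e) (e q e)\<^sup>-\<^sup>1\<close> and \<open>\<alpha>\<close> restricts to a congruence of \<open>G\<close>. So they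
  form a matrix with constant rows. The congruence \<open>\<alpha>\<close> may exceed \<open>\<H>\<close>, as it does for the
  lower central series, where it is the full relation.
\<close>

lemma lift_centralizes:
  assumes e: "idempotent e" and \<alpha>: "ualg_congruence (semigroup_alg S (\<cdot>)) \<alpha>"
    and B: "ualg_congruence (group_alg (local_group e)) B"
    and N: "ualg_congruence (group_alg (local_group e)) N"
    and commute: "commute_modulo (local_group e) (restrict_congruence e \<alpha>) B N"
  shows "centralizes (semigroup_alg S (\<cdot>)) \<alpha> (lift_congruence e B) (lift_congruence e N)"
  unfolding centralizes_def semigroup_alg_carrier
proof (intro allI impI ballI)
  interpret G: group_congruences "local_group e" "restrict_congruence e \<alpha>" B N
    using local_group[OF e] restrict_is_congruence[OF e \<alpha>] B N commute
    by (simp add: group_congruences_def group_congruences_axioms_def)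
  let ?SA = "semigroup_alg S (\<cdot>)" and ?\<theta> = "lift_congruence e B"
  have \<theta>: "ualg_congruence ?SA ?\<theta>" using e B by (rule lift_is_congruence)
  fix n t a b c d
  assume h: "1 \<le> n" "t \<in> term_functions ?SA (n + 1)" "a \<in> S" "b \<in> S"
    "length c = n" "length d = n" "set c \<subseteq> S" "set d \<subseteq> S"
    "(a, b) \<in> \<alpha>" "\<forall>i < n. (c ! i, d ! i) \<in> ?\<theta>" "(t (a # c), t (a # d)) \<in> lift_congruence e N"
  note SD = ualg_congruenceD[OF \<alpha>, unfolded semigroup_alg_carrier]
    and TD = ualg_congruenceD[OF \<theta>, unfolded semigroup_alg_carrier]
  have resp_\<theta>: "(p (x # c), p (x # d)) \<in> ?\<theta>" if "p \<in> term_functions ?SA (n + 1)" "x \<in> S" for p x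
    using h that(2) TD(2) by (intro term_function_respects_congruence[OF \<theta> that(1)])
      (simp_all, simp add: list_all2_conv_all_nth)
  have resp_\<alpha>: "(p (a # c), p (b # c)) \<in> \<alpha>" if "p \<in> term_functions ?SA (n + 1)" for p
    using h SD(2) by (intro term_function_respects_congruence[OF \<alpha> that(1)])
      (simp_all, auto simp: list_all2_conv_all_nth subset_iff)
  have \<alpha>_mult: "\<And>x y u v. (x, y) \<in> \<alpha> \<Longrightarrow> (u, v) \<in> \<alpha> \<Longrightarrow> (x \<cdot> u, y \<cdot> v) \<in> \<alpha>"
    using \<alpha> by (auto simp: semigroup_congruence_iff)
  have \<alpha>_sandwich: "(e \<cdot> x \<cdot> e, e \<cdot> y \<cdot> e) \<in> restrict_congruence e \<alpha>" if "(x, y) \<in> \<alpha>" for x y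
  proof -
    have "x \<in> S" "y \<in> S" using that SD(1) by blast+
    moreover have "(e \<cdot> x \<cdot> e, e \<cdot> y \<cdot> e) \<in> \<alpha>"
      using that SD(2) e by (intro \<alpha>_mult) simp_all
    ultimately show ?thesis
      using sandwich_closed[OF e] unfolding restrict_congruence_def by blast
  qed
  have "G.agree (e \<cdot> t (a # c) \<cdot> e) (e \<cdot> t (a # d) \<cdot> e) (e \<cdot> t (b # c) \<cdot> e) (e \<cdot> t (b # d) \<cdot> e)"
    using h(2)
  proof (induction rule: semigroup_term_induct)
    case (proj i)
    show ?case
    proof (cases i)
      case 0
      then show ?thesis using G.agree_const_rows[OF \<alpha>_sandwich[OF h(9)]] by simp
    next
      case (Suc j)
      then have "(e \<cdot> c ! j \<cdot> e, e \<cdot> d ! j \<cdot> e) \<in> B"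
        using h(10) proj by (auto simp: lift_congruence_def)
      then show ?thesis using G.agree_const_columns Suc by simp
    qed
  next
    case (mult p q)
    have ex: "\<exists>w\<in>carrier (local_group e).
        e \<cdot> (p (x # c) \<cdot> q (x # c)) \<cdot> e = (e \<cdot> p (x # c) \<cdot> e) \<cdot> w \<cdot> (e \<cdot> q (x # c) \<cdot> e) \<and>
        e \<cdot> (p (x # d) \<cdot> q (x # d)) \<cdot> e = (e \<cdot> p (x # d) \<cdot> e) \<cdot> w \<cdot> (e \<cdot> q (x # d) \<cdot> e)"
      if "x \<in> S" for x
    proof -
      have "(p (x # c), p (x # d)) \<in> green_L S (\<cdot>)" "(q (x # c), q (x # d)) \<in> green_R S (\<cdot>)"
        using resp_\<theta> mult.hyps that by (auto simp: lift_congruence_def green_H_def)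
      from sandwich_mult[OF e this] show ?thesis by metis
    qed
    from ex[OF h(3)] obtain v where v: "v \<in> carrier (local_group e)"
      "e \<cdot> (p (a # c) \<cdot> q (a # c)) \<cdot> e = (e \<cdot> p (a # c) \<cdot> e) \<cdot> v \<cdot> (e \<cdot> q (a # c) \<cdot> e)"
      "e \<cdot> (p (a # d) \<cdot> q (a # d)) \<cdot> e = (e \<cdot> p (a # d) \<cdot> e) \<cdot> v \<cdot> (e \<cdot> q (a # d) \<cdot> e)"
      by blast
    from ex[OF h(4)] obtain w where w: "w \<in> carrier (local_group e)"
      "e \<cdot> (p (b # c) \<cdot> q (b # c)) \<cdot> e = (e \<cdot> p (b # c) \<cdot> e) \<cdot> w \<cdot> (e \<cdot> q (b # c) \<cdot> e)"
      "e \<cdot> (p (b # d) \<cdot> q (b # d)) \<cdot> e = (e \<cdot> p (b # d) \<cdot> e) \<cdot> w \<cdot> (e \<cdot> q (b # d) \<cdot> e)"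
      by blast
    note A = G.group_congruenceD[OF restrict_is_congruence[OF e \<alpha>], unfolded local_group_simps(2)]
    \<comment> \<open>recovers a middle factor \<open>r\<close> from \<open>x r y\<close>\<close>
    have mid: "r = inv\<^bsub>local_group e\<^esub> x \<cdot> (x \<cdot> r \<cdot> y) \<cdot> inv\<^bsub>local_group e\<^esub> y"
      if "x \<in> carrier (local_group e)" "y \<in> carrier (local_group e)" "r \<in> carrier (local_group e)"
      for x y r
    proof -
      have "inv\<^bsub>local_group e\<^esub> x \<otimes>\<^bsub>local_group e\<^esub> (x \<otimes>\<^bsub>local_group e\<^esub> r \<otimes>\<^bsub>local_group e\<^esub> y)
          \<otimes>\<^bsub>local_group e\<^esub> inv\<^bsub>local_group e\<^esub> y
        = (inv\<^bsub>local_group e\<^esub> x \<otimes>\<^bsub>local_group e\<^esub> x) \<otimes>\<^bsub>local_group e\<^esub> r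
          \<otimes>\<^bsub>local_group e\<^esub> (y \<otimes>\<^bsub>local_group e\<^esub> inv\<^bsub>local_group e\<^esub> y)"
        using that by (simp only: G.m_assoc G.m_closed G.inv_closed)
      also have "\<dots> = r" unfolding G.l_inv[OF that(1)] G.r_inv[OF that(2)]
        using G.l_one[OF that(3)] G.r_one[OF that(3)] by (simp only:)
      finally show ?thesis unfolding local_group_simps(2) by (rule sym)
    qed
    have c: "p (a # c) \<in> S" "q (a # c) \<in> S" "p (b # c) \<in> S" "q (b # c) \<in> S"
      using resp_\<alpha> mult.hyps SD(1) by blast+
    note pa = resp_\<alpha>[OF mult.hyps(1)] and qa = resp_\<alpha>[OF mult.hyps(2)]
    have "(inv\<^bsub>local_group e\<^esub> (e \<cdot> p (a # c) \<cdot> e) \<cdot> (e \<cdot> (p (a # c) \<cdot> q (a # c)) \<cdot> e)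
          \<cdot> inv\<^bsub>local_group e\<^esub> (e \<cdot> q (a # c) \<cdot> e),
        inv\<^bsub>local_group e\<^esub> (e \<cdot> p (b # c) \<cdot> e) \<cdot> (e \<cdot> (p (b # c) \<cdot> q (b # c)) \<cdot> e)
          \<cdot> inv\<^bsub>local_group e\<^esub> (e \<cdot> q (b # c) \<cdot> e)) \<in> restrict_congruence e \<alpha>"
      by (rule A(6)[OF A(6)[OF A(7)[OF \<alpha>_sandwich[OF pa]] \<alpha>_sandwich[OF \<alpha>_mult[OF pa qa]]]
            A(7)[OF \<alpha>_sandwich[OF qa]]])
    then have vw: "(v, w) \<in> restrict_congruence e \<alpha>"
      unfolding v(2) w(2) mid[OF sandwich_closed[OF e c(1)] sandwich_closed[OF e c(2)] v(1), symmetric]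
        mid[OF sandwich_closed[OF e c(3)] sandwich_closed[OF e c(4)] w(1), symmetric] .
    show ?case
      unfolding v(2,3) w(2,3)
      using G.agree_mult[OF G.agree_mult[OF mult.IH(1) G.agree_const_rows[OF vw]] mult.IH(2)]
      unfolding local_group_simps(2) .
  qed
  moreover have "(e \<cdot> t (a # c) \<cdot> e, e \<cdot> t (a # d) \<cdot> e) \<in> N"
    using h(11) by (simp add: lift_congruence_def)
  ultimately have "(e \<cdot> t (b # c) \<cdot> e, e \<cdot> t (b # d) \<cdot> e) \<in> N"
    by (rule G.agree_imp_related)
  moreover have "(t (b # c), t (b # d)) \<in> green_H S (\<cdot>)"
    using resp_\<theta>[OF h(2,4)] by (simp add: lift_congruence_def)
  ultimately show "(t (b # c), t (b # d)) \<in> lift_congruence e N"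
    by (simp add: lift_congruence_def)
qed


section \<open>Comparison of the series\<close>

text \<open>
  Centrality in \<open>S\<close> gives commutation in \<open>G = e S e\<close> by semigroup terms, and commutation gives back
  centrality in \<open>G\<close> for all group terms, including those with inverses.
\<close>

lemma local_series_subset:
  assumes e: "idempotent e"
  shows "commutator_series c (group_alg (local_group e)) k
    \<subseteq> restrict_congruence e (commutator_series c (semigroup_alg S (\<cdot>)) k)"
proof (induction k)
  case 0
  show ?case by (auto simp: one_cong_def restrict_congruence_def)
next
  case (Suc k)
  interpret G: group "local_group e" using e by (rule local_group)
  let ?S = "semigroup_alg S (\<cdot>)" and ?G = "group_alg (local_group e)"
  have SC: "ualg_closed ?S" using semigroup by (rule semigroup_alg_closed)
  have GC: "ualg_closed ?G" using G.is_group by (rule group_alg_closed)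
  define \<alpha> where "\<alpha> = (if c then one_cong ?S else commutator_series c ?S k)"
  let ?\<beta> = "commutator_series c ?S k" and ?\<delta> = "commutator_series c ?S (Suc k)"
  let ?r = "restrict_congruence e"
  have C: "centralizes ?S \<alpha> ?\<beta> ?\<delta>"
    unfolding \<alpha>_def by (rule commutator_series_centralizes[OF SC])
  have cong: "ualg_congruence ?G (?r \<alpha>)" "ualg_congruence ?G (?r ?\<beta>)" "ualg_congruence ?G (?r ?\<delta>)"
    using commutator_series_congruence[OF SC] one_cong_congruence[OF SC]
    by (intro restrict_is_congruence[OF e]; simp add: \<alpha>_def del: commutator_series.simps)+
  note bD = ualg_congruenceD[OF cong(2)] and dD = ualg_congruenceD[OF cong(3)]
  have "commute_modulo (local_group e) (?r \<alpha>) (?r ?\<beta>) (?r ?\<delta>)"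
    unfolding commute_modulo_def local_group_simps(2,3)
  proof (intro allI impI)
    fix a b assume ab: "(e, a) \<in> ?r \<alpha>" "(e, b) \<in> ?r ?\<beta>"
    have c: "a \<in> carrier (local_group e)" "b \<in> carrier (local_group e)"
      using ab unfolding restrict_congruence_def by blast+
    have ba: "b \<cdot> a \<in> carrier (local_group e)" "a \<cdot> b \<in> carrier (local_group e)"
      using G.m_closed[OF c(2,1)] G.m_closed[OF c] unfolding local_group_simps(2) by blast+
    have "(b, b) \<in> ?r ?\<delta>" using dD(2) c by simp
    moreover have "(b, e) \<in> ?r ?\<beta>" using bD(3) ab by blast
    ultimately have "(b \<cdot> a, a \<cdot> b) \<in> ?\<delta>"
      using ab c ba e
      by - (rule centralizes_imp_commute[OF _ C, where e = e],
        simp_all add: restrict_congruence_def semigroup_alg_def del: commutator_series.simps)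
    then show "(b \<cdot> a, a \<cdot> b) \<in> ?r ?\<delta>" using ba unfolding restrict_congruence_def by blast
  qed
  then interpret gc: group_congruences "local_group e" "?r \<alpha>" "?r ?\<beta>" "?r ?\<delta>"
    using G.is_group cong by (simp add: group_congruences_def group_congruences_axioms_def)
  show ?case
  proof (rule commutator_series_Suc_subset[OF GC cong(3) gc.commute_modulo_imp_centralizes])
    show "(if c then one_cong ?G else commutator_series c ?G k) \<subseteq> ?r \<alpha>"
      using Suc.IH by (auto simp: \<alpha>_def one_cong_def restrict_congruence_def)
    show "commutator_series c ?G k \<subseteq> ?r ?\<beta>" by (rule Suc.IH)
  qed
qed

text \<open>
  The index is shifted because the first commutator in \<open>S\<close> is spent on reaching \<open>\<H>\<close>, the lift of
  the full relation of \<open>G\<close>.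
\<close>

lemma series_subset_lift:
  assumes e: "idempotent e"
  shows "commutator_series c (semigroup_alg S (\<cdot>)) (Suc k)
    \<subseteq> lift_congruence e (commutator_series c (group_alg (local_group e)) k)"
proof (induction k)
  case 0
  have SC: "ualg_closed (semigroup_alg S (\<cdot>))" using semigroup by (rule semigroup_alg_closed)
  have "commutator_series c (semigroup_alg S (\<cdot>)) (Suc 0) \<subseteq> green_H S (\<cdot>)"
    using commutator_series_Suc_subset[OF SC green_H_congruence green_H_centralizes] by blast
  moreover have "green_H S (\<cdot>) \<subseteq> lift_congruence e (one_cong (group_alg (local_group e)))"
  proof -
    have "(e \<cdot> u \<cdot> e, e \<cdot> v \<cdot> e) \<in> one_cong (group_alg (local_group e))"
      if "(u, v) \<in> green_H S (\<cdot>)" for u v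
    proof -
      have "u \<in> S" "v \<in> S" using that by (simp_all add: green_H_def green_R_iff)
      then show ?thesis
        using sandwich_closed[OF e] unfolding one_cong_def group_alg_local_group_carrier by blast
    qed
    then show ?thesis by (auto simp: lift_congruence_def)
  qed
  ultimately show ?case unfolding commutator_series.simps(1) by (rule subset_trans)
next
  case (Suc k)
  interpret G: group "local_group e" using e by (rule local_group)
  let ?S = "semigroup_alg S (\<cdot>)" and ?G = "group_alg (local_group e)"
  have SC: "ualg_closed ?S" using semigroup by (rule semigroup_alg_closed)
  have GC: "ualg_closed ?G" using G.is_group by (rule group_alg_closed)
  let ?B = "commutator_series c ?G k" and ?N = "commutator_series c ?G (Suc k)"
  define A where "A = (if c then one_cong ?G else ?B)"
  define \<alpha> where "\<alpha> = (if c then one_cong ?S else lift_congruence e ?B)"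
  have cong: "ualg_congruence ?G ?B" "ualg_congruence ?G ?N"
    using GC by (rule commutator_series_congruence)+
  have \<alpha>: "ualg_congruence ?S \<alpha>"
    using one_cong_congruence[OF SC] lift_is_congruence[OF e cong(1)] unfolding \<alpha>_def by presburger
  have "ualg_congruence ?G A" using one_cong_congruence[OF GC] cong(1) unfolding A_def by presburger
  then have "A \<subseteq> carrier (local_group e) \<times> carrier (local_group e)"
    using ualg_congruenceD(1) by fastforce
  then have "commute_modulo (local_group e) A ?B ?N"
    using G.centralizes_imp_commute_modulo[OF cong, of A]
      commutator_series_centralizes[OF GC, of c k] unfolding A_def by blast
  moreover have "restrict_congruence e \<alpha> \<subseteq> A"
  proof (cases c)
    case True
    then show ?thesis by (auto simp: A_def one_cong_def restrict_congruence_def)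
  next
    case False
    then show ?thesis unfolding A_def \<alpha>_def if_not_P[OF False] by (auto intro: restrict_lift)
  qed
  ultimately have "commute_modulo (local_group e) (restrict_congruence e \<alpha>) ?B ?N"
    unfolding commute_modulo_def by blast
  then have C: "centralizes ?S \<alpha> (lift_congruence e ?B) (lift_congruence e ?N)"
    by (rule lift_centralizes[OF e \<alpha> cong])
  show ?case
  proof (rule commutator_series_Suc_subset[OF SC lift_is_congruence[OF e cong(2)] C])
    show "(if c then one_cong ?S else commutator_series c ?S (Suc k)) \<subseteq> \<alpha>"
      unfolding \<alpha>_def using Suc.IH by (metis subset_refl)
  qed (rule Suc.IH)
qed

text \<open>
  If the series of \<open>G = e S e\<close> reaches equality after \<open>n\<close> steps, that of \<open>S\<close> does so after
  \<open>n + 1\<close> steps. In the other direction the number of steps does not increase.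
\<close>

theorem series_terminates_iff_local:
  assumes e: "idempotent e"
  shows "series_terminates c (semigroup_alg S (\<cdot>)) \<longleftrightarrow>
    series_terminates c (group_alg (local_group e))"
proof
  interpret G: group "local_group e" using e by (rule local_group)
  let ?S = "semigroup_alg S (\<cdot>)" and ?G = "group_alg (local_group e)"
  have zero: "zero_cong A \<subseteq> commutator_series c A n" if "ualg_closed A" for A :: "'a ualg" and n
    using ualg_congruenceD(2)[OF commutator_series_congruence[OF that]]
    by (auto simp: zero_cong_def)
  have SC: "ualg_closed ?S" using semigroup by (rule semigroup_alg_closed)
  have GC: "ualg_closed ?G" using G.is_group by (rule group_alg_closed)
  {
    assume "series_terminates c ?S"
    then obtain n where n: "n \<ge> 1" "commutator_series c ?S n = zero_cong ?S"
      by (auto simp: series_terminates_def)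
    have "commutator_series c ?G n \<subseteq> zero_cong ?G"
      using local_series_subset[OF e, of c n] unfolding n(2)
      by (auto simp: restrict_congruence_def zero_cong_def)
    then show "series_terminates c ?G"
      using n(1) zero[OF GC] unfolding series_terminates_def by blast
  }
  {
    assume "series_terminates c ?G"
    then obtain n where n: "n \<ge> 1" "commutator_series c ?G n = zero_cong ?G"
      by (auto simp: series_terminates_def)
    have "commutator_series c ?S (Suc n) \<subseteq> zero_cong ?S"
      using series_subset_lift[OF e, of c n] lift_zero[OF e] unfolding n(2) by blast
    then have "commutator_series c ?S (Suc n) = zero_cong ?S"
      using zero[OF SC, of "Suc n"] by blast
    moreover have "Suc n \<ge> 1" by simp
    ultimately show "series_terminates c ?S"
      unfolding series_terminates_def by blast
  }
qed

lemma series_terminates_iff_H_classes: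
  "series_terminates c (semigroup_alg S (\<cdot>)) \<longleftrightarrow>
    (\<forall>X \<in> S // green_H S (\<cdot>). \<exists>e. group \<lparr>carrier = X, monoid.mult = (\<cdot>), one = e\<rparr> \<and>
       series_terminates c (group_alg \<lparr>carrier = X, monoid.mult = (\<cdot>), one = e\<rparr>))"
proof -
  have G: "\<lparr>carrier = carrier (local_group e), monoid.mult = (\<cdot>), one = e\<rparr> = local_group e" for e
    by (simp add: local_group_def)
  have "(\<exists>e'. group \<lparr>carrier = carrier (local_group e), monoid.mult = (\<cdot>), one = e'\<rparr> \<and>
       series_terminates c (group_alg \<lparr>carrier = carrier (local_group e), monoid.mult = (\<cdot>), one = e'\<rparr>))
     \<longleftrightarrow> series_terminates c (group_alg (local_group e))" (is "?L \<longleftrightarrow> ?R") if e: "idempotent e" for e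
  proof
    assume ?L
    then show ?R using local_group_identity_unique[OF e] G by metis
  next
    assume ?R
    then show ?L using local_group[OF e] G by metis
  qed
  then have "(\<forall>X \<in> S // green_H S (\<cdot>). \<exists>e. group \<lparr>carrier = X, monoid.mult = (\<cdot>), one = e\<rparr> \<and>
       series_terminates c (group_alg \<lparr>carrier = X, monoid.mult = (\<cdot>), one = e\<rparr>)) \<longleftrightarrow>
     (\<forall>e. idempotent e \<longrightarrow> series_terminates c (group_alg (local_group e)))"
    unfolding green_H_classes by blast
  also have "\<dots> \<longleftrightarrow> series_terminates c (semigroup_alg S (\<cdot>))"
  \<comment> \<open>an empty semigroup has no idempotent to compare with; its series is empty from the start\<close>
  proof (cases "S = {}")
    case True
    have "commutator_series c (semigroup_alg S (\<cdot>)) 1 \<subseteq> S \<times> S"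
      using ualg_congruenceD(1)[OF commutator_series_congruence[OF semigroup_alg_closed[OF semigroup]]]
      unfolding semigroup_alg_carrier .
    then have "commutator_series c (semigroup_alg S (\<cdot>)) 1 = zero_cong (semigroup_alg S (\<cdot>))"
      using True by (simp add: zero_cong_def semigroup_alg_def)
    then have "series_terminates c (semigroup_alg S (\<cdot>))"
      unfolding series_terminates_def by (intro exI[of _ 1] conjI le_refl)
    moreover have "\<not> idempotent e" for e using True idempotentD(1) by blast
    ultimately show ?thesis by blast
  next
    case False
    then obtain e where "idempotent e" using in_local_group by blast
    then show ?thesis using series_terminates_iff_local by metis
  qed
  finally show ?thesis by (rule sym)
qed

end

section \<open>Recognising completely simple semigroups\<close>

text \<open>
  If \<open>e \<le> f\<close> are related by a member of the series, apply centrality to the term \<open>x y\<close>: the values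
  \<open>e e = e = e f\<close> coincide in the row of \<open>e\<close>, so the values \<open>f e = e\<close> and \<open>f f = f\<close> in the row of
  \<open>f\<close> are related by the next member.
\<close>

lemma series_terminates_imp_primitive:
  assumes S: "semigroup_on S m" and T: "series_terminates c (semigroup_alg S m)"
    and e: "e \<in> S" "m e e = e" and f: "f \<in> S" "m f f = f" and ef: "m e f = e" "m f e = e"
  shows "e = f"
proof -
  let ?S = "semigroup_alg S m"
  have SC: "ualg_closed ?S" using S by (rule semigroup_alg_closed)
  have carr: "carrier ?S = S" by (simp add: semigroup_alg_def)
  have "(e, f) \<in> commutator_series c ?S k" for k
  proof (induction k)
    case 0
    show ?case using e f by (simp add: one_cong_def carr)
  next
    case (Suc k)
    let ?\<delta> = "commutator_series c ?S (Suc k)"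
    let ?t = "\<lambda>xs. m (xs ! 0) (xs ! 1)"
    have t: "?t \<in> term_functions ?S (1 + 1)"
      by (rule binary_op_term) (simp_all add: semigroup_alg_def term_functions.proj)
    have ef_row: "(e, f) \<in> (if c then one_cong ?S else commutator_series c ?S k)"
      using Suc.IH e f by (cases c) (simp_all add: one_cong_def carr)
    have te: "(?t (e # [e]), ?t (e # [f])) \<in> ?\<delta>"
      using ualg_congruenceD(2)[OF commutator_series_congruence[OF SC, of c "Suc k"], of e] e ef
      by (simp add: carr del: commutator_series.simps)
    have rows: "\<forall>i < 1. ([e] ! i, [f] ! i) \<in> commutator_series c ?S k"
      "set [e] \<subseteq> carrier ?S" "set [f] \<subseteq> carrier ?S" "length [e] = 1" "length [f] = 1"
      "e \<in> carrier ?S" "f \<in> carrier ?S"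
      using Suc.IH e f by (simp_all add: carr)
    have "(?t (f # [e]), ?t (f # [f])) \<in> ?\<delta>"
      by (rule commutator_series_centralizes[OF SC, of c k, unfolded centralizes_def, rule_format,
            OF le_refl t rows(6,7,4,5) _ _ ef_row _ te])
        (use rows in \<open>simp_all del: commutator_series.simps\<close>)
    then show ?case using ef f by (simp del: commutator_series.simps)
  qed
  moreover obtain n where "commutator_series c ?S n = zero_cong ?S"
    using T by (auto simp: series_terminates_def)
  ultimately have "(e, f) \<in> zero_cong ?S" by metis
  then show ?thesis by (simp add: zero_cong_def Id_on_iff)
qed

text \<open>
  By simplicity \<open>f = x e y\<close>. The element \<open>a = f x e\<close> satisfies \<open>a y = f\<close> and \<open>a = a e = a f = f a\<close>. The
  identity \<open>k\<close> of the group that contains \<open>a\<close> fixes \<open>f = a y\<close> from the left; being \<open>z a\<close> for the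
  inverse \<open>z\<close> of \<open>a\<close>, it is fixed from the right by \<open>f\<close> and \<open>e\<close>. Hence \<open>k = f\<close> and
  \<open>f = f e = e\<close>.
\<close>

lemma simple_union_of_groups_imp_primitive:
  assumes S: "simple_semigroup S m"
    and groups: "\<And>a. a \<in> S \<Longrightarrow>
      \<exists>k\<in>S. \<exists>z\<in>S. m k a = a \<and> m a k = a \<and> m a z = k \<and> m z a = k"
    and e: "e \<in> S" "m e e = e" and f: "f \<in> S" "m f f = f" and ef: "m e f = e" "m f e = e"
  shows "e = f"
proof -
  have closed: "\<And>x y. x \<in> S \<Longrightarrow> y \<in> S \<Longrightarrow> m x y \<in> S"
    and assoc: "\<And>x y z. x \<in> S \<Longrightarrow> y \<in> S \<Longrightarrow> z \<in> S \<Longrightarrow> m (m x y) z = m x (m y z)"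
    using S by (auto simp: simple_semigroup_def semigroup_on_def)
  let ?I = "{m (m x e) y |x y. x \<in> S \<and> y \<in> S}"
  have "semigroup_ideal S m ?I"
    unfolding semigroup_ideal_def
  proof (intro conjI ballI)
    show "?I \<noteq> {}" using e by blast
    show "?I \<subseteq> S" using e closed by blast
    fix s i assume s: "s \<in> S" and "i \<in> ?I"
    then obtain x y where i: "i = m (m x e) y" "x \<in> S" "y \<in> S" by blast
    have "m s i = m (m (m s x) e) y" "m i s = m (m x e) (m y s)"
      unfolding i(1) using i(2,3) s e(1) by (simp_all only: assoc closed)
    then show "m s i \<in> ?I" "m i s \<in> ?I" using i(2,3) s closed by blast+
  qed
  then have "f \<in> ?I" using S f(1) unfolding simple_semigroup_def by blast
  then obtain x y where xy: "x \<in> S" "y \<in> S" "f = m (m x e) y" by blast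
  define a where "a = m (m f x) e"
  have a: "a \<in> S" using xy e f closed by (simp add: a_def)
  have af: "m a f = a" "m a e = a" "m f a = a"
  proof -
    have "m a f = m (m f x) (m e f)" "m a e = m (m f x) (m e e)" "m f a = m (m (m f f) x) e"
      unfolding a_def using xy(1) e(1) f(1) by (simp_all only: assoc closed)
    then show "m a f = a" "m a e = a" "m f a = a" using e f ef by (simp_all add: a_def)
  qed
  have ay: "m a y = f"
  proof -
    have "m a y = m f (m (m x e) y)"
      unfolding a_def using xy(1,2) e(1) f(1) by (simp only: assoc closed)
    then show ?thesis using xy(3) f(2) by simp
  qed
  obtain k z where k: "k \<in> S" "z \<in> S" "m k a = a" "m a k = a" "m a z = k" "m z a = k"
    using groups[OF a] by blast
  have "m k (m a y) = m (m k a) y" using k(1) a xy(2) by (simp only: assoc)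
  then have "m k f = f" using k(3) ay by simp
  moreover have "m (m z a) f = m z (m a f)" using k(2) a f(1) by (simp only: assoc)
  then have "m k f = k" using k(6) af(1) by simp
  moreover have "m (m z a) e = m z (m a e)" using k(2) a e(1) by (simp only: assoc)
  then have "m k e = k" using k(6) af(2) by simp
  ultimately show ?thesis using ef by simp
qed

lemma completely_simple_if_H_classes_groups:
  assumes S: "regular_semigroup S m" "simple_semigroup S m"
    and groups: "\<forall>X \<in> S // green_H S m. \<exists>e. group \<lparr>carrier = X, monoid.mult = m, one = e\<rparr>"
  shows "completely_simple S m"
proof
  show "regular_semigroup S m" by fact
  fix e f assume "e \<in> S" "f \<in> S" "m e e = e" "m f f = f" "m e f = e" "m f e = e"
  moreover have "\<exists>k\<in>S. \<exists>z\<in>S. m k a = a \<and> m a k = a \<and> m a z = k \<and> m z a = k" if a: "a \<in> S" for a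
  proof -
    let ?X = "green_H S m `` {a}"
    obtain k where "group \<lparr>carrier = ?X, monoid.mult = m, one = k\<rparr>"
      using groups quotientI[OF a] by blast
    then interpret G: group "\<lparr>carrier = ?X, monoid.mult = m, one = k\<rparr>" .
    have aX: "a \<in> ?X" using a by (simp add: green_H_def green_R_def green_L_def)
    have X: "?X \<subseteq> S" by (auto simp: green_H_def green_R_def)
    have "k \<in> ?X" "m k a = a" "m a k = a"
      using G.one_closed G.l_one[of a] G.r_one[of a] aX by simp_all
    moreover obtain z where "z \<in> ?X" "m a z = k" "m z a = k"
      using G.inv_closed[of a] G.r_inv[of a] G.l_inv[of a] aX by auto
    ultimately show ?thesis using X by blast
  qed
  ultimately show "e = f" using simple_union_of_groups_imp_primitive[OF S(2)] by blast
qed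

lemma series_terminates_iff:
  assumes S: "regular_semigroup S m"
  shows "series_terminates c (semigroup_alg S m) \<longleftrightarrow> simple_semigroup S m \<and>
    (\<forall>X \<in> S // green_H S m. \<exists>e. group \<lparr>carrier = X, monoid.mult = m, one = e\<rparr> \<and>
       series_terminates c (group_alg \<lparr>carrier = X, monoid.mult = m, one = e\<rparr>))"
    (is "?L \<longleftrightarrow> ?simple \<and> ?groups")
proof
  assume ?L
  moreover have "semigroup_on S m" using S by (simp add: regular_semigroup_def)
  ultimately interpret completely_simple S m
    by unfold_locales (rule S, rule series_terminates_imp_primitive)
  show "?simple \<and> ?groups" using \<open>?L\<close> simple series_terminates_iff_H_classes by blast
next
  assume R: "?simple \<and> ?groups"
  then interpret completely_simple S m
    using S by (intro completely_simple_if_H_classes_groups) blast+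
  show ?L using R series_terminates_iff_H_classes by blast
qed

theorem theorem1p2:
  fixes S :: "'a set" and m :: "'a \<Rightarrow> 'a \<Rightarrow> 'a"
  assumes "regular_semigroup S m"
  shows "(ualg_nilpotent (semigroup_alg S m) \<longleftrightarrow>
            simple_semigroup S m \<and> (\<forall>X \<in> S // green_H S m. is_nilpotent_group X m)) \<and>
         (ualg_solvable (semigroup_alg S m) \<longleftrightarrow>
            simple_semigroup S m \<and> (\<forall>X \<in> S // green_H S m. is_solvable_group X m))"
  unfolding is_nilpotent_group_def is_solvable_group_def ualg_nilpotent_iff ualg_solvable_iff
  using series_terminates_iff[OF assms] by blast

end
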